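(* Consider two function classes $F(\alpha_1,M_1)$ and $F(\alpha_2,M_2)$ with $0<\alpha_1<\alpha_2$ and $M_1,M_2>0$. Let $0<x_0<1$ and $c_n=d_n n^{-1/(1+2\alpha_1)}$ with $d_n\ge 0$. If $\limsup_{n\to\infty}d_n(\log n)^{-1}=0$, then $$\inf_{(\hat f_n)}\ \max_{i=1,2}\ \limsup_{n\to\infty}\ n^{2\alpha_i/(1+2\alpha_i)}\sup_{f\in F(\alpha_i,M_i)}R(\hat f_n,f;x_0,c_n)=\infty,$$ where the infimum is over all sequences of estimators $(\hat f_n)$. More specifically, suppose $\hat f_n$ is any estimator satisfying $$\limsup_{n\to\infty} n^{r}\sup_{f\in F(\alpha_2,M_2)}R(\hat f_n,f;x_0,c_n)<\infty$$ for some $r>\frac{2\alpha_1}{1+2\alpha_1}$. (i) If $\limsup_{n\to\infty}d_n(\log n)^{-1/(1+2\alpha_1)}=0$, then $$\liminf_{n\to\infty}\Big(\frac{n}{\log n}\Big)^{2\alpha_1/(1+2\alpha_1)}\sup_{f\in F(\alpha_1,M_1)}R(\hat f_n,f;x_0,c_n)>0.$$ (ii) If $\liminf_{n\to\infty}d_n(\log n)^{-1/(1+2\alpha_1)}>0$ and $\limsup_{n\to\infty}d_n(\log n)^{-1}=0$, then $$\liminf_{n\to\infty}n^{2\alpha_1/(1+2\alpha_1)}\frac{d_n}{\log n}\sup_{f\in F(\alpha_1,M_1)}R(\hat f_n,f;x_0,c_n)>0.$$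
   Context: Observation model: for each $n$ one observes the Gaussian process $Z_n^*(t)=\int_0^t f(x)\,dx+\frac{1}{\sqrt n}B^*(t)$, $0\le t\le 1$, where $B^*$ is a standard Brownian motion and $f:[0,1]\to\mathbb{R}$ is unknown. An estimator $\hat f_n$ (really a sequence indexed by $n$) is a measurable function of the observation $Z_n^*$; $E_f$ denotes expectation when the true function is $f$. Hölder class: $F(\alpha,M)=\{f:|f^{(k)}(x)-f^{(k)}(y)|\le M|x-y|^{\alpha-k},\ 0\le x<y\le 1\}$, where $k$ is the greatest integer strictly less than $\alpha$. Risk: $R(\hat f_n,f;x_0,c_n)=\frac{1}{2c_n}E_f\int_{x_0-c_n}^{x_0+c_n}(\hat f_n(x)-f(x))^2\,dx$ when $c_n>0$; the case $c_n=0$ is interpreted as the pointwise risk $E_f(\hat f_n(x_0)-f(x_0))^2$. The neighborhoods satisfy $[x_0-c_n,x_0+c_n]\subset[0,1]$. *)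

theory Defs
  imports "HOL-Probability.Probability"
begin

locale standard_brownian_motion = prob_space P
  for P :: "'a measure" and B :: "real \<Rightarrow> 'a \<Rightarrow> real" +
  assumes measurable_B: "\<And>t. t \<in> {0..1} \<Longrightarrow> B t \<in> borel_measurable P"
    and B_zero: "AE \<omega> in P. B 0 \<omega> = 0"
    and B_continuous: "AE \<omega> in P. continuous_on {0..1} (\<lambda>t. B t \<omega>)"
    and B_increment: "\<And>s t. 0 \<le> s \<Longrightarrow> s < t \<Longrightarrow> t \<le> 1 \<Longrightarrow>
      distributed P lborel (\<lambda>\<omega>. B t \<omega> - B s \<omega>) (normal_density 0 (sqrt (t - s)))"
    and B_indep: "\<And>(m::nat) \<tau>. 0 \<le> \<tau> 0 \<Longrightarrow> (\<forall>i<m. \<tau> i < \<tau> (Suc i)) \<Longrightarrow> \<tau> m \<le> 1 \<Longrightarrow>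
      indep_vars (\<lambda>_. borel) (\<lambda>i \<omega>. B (\<tau> (Suc i)) \<omega> - B (\<tau> i) \<omega>) {..<m}"

definition observation ::
  "(real \<Rightarrow> 'a \<Rightarrow> real) \<Rightarrow> nat \<Rightarrow> (real \<Rightarrow> real) \<Rightarrow> 'a \<Rightarrow> real \<Rightarrow> real" where
  "observation B n f \<omega> =
     (\<lambda>t\<in>{0..1}. (LINT x:{0..t}|lborel. f x) + 1 / sqrt (real n) * B t \<omega>)"

text \<open>The observed path is an element of the product space over the index set \<open>[0,1]\<close>, whose
  sigma-algebra is generated by the evaluations. Measurability of an estimator is required jointly
  in the path and the argument \<open>x\<close>, so that the integrated squared error is a random variable.\<close>

definition estimator :: "((real \<Rightarrow> real) \<Rightarrow> real \<Rightarrow> real) \<Rightarrow> bool" where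
  "estimator \<delta> \<longleftrightarrow> (\<lambda>(z, x). \<delta> z x) \<in>
     borel_measurable ((\<Pi>\<^sub>M t\<in>{0..1::real}. (borel :: real measure)) \<Otimes>\<^sub>M restrict_space borel {0..1})"

definition holder_order :: "real \<Rightarrow> nat" where
  "holder_order \<alpha> = nat (\<lceil>\<alpha>\<rceil> - 1)"

lemma holder_order_less_iff:
  assumes "\<alpha> > 0"
  shows "real k < \<alpha> \<longleftrightarrow> k \<le> holder_order \<alpha>"
  using assms unfolding holder_order_def by linarith

lemma holder_order_eq_Greatest:
  assumes "\<alpha> > 0"
  shows "holder_order \<alpha> = (GREATEST k. real k < \<alpha>)"
  using holder_order_less_iff[OF assms] by (intro Greatest_equality[symmetric]) auto

text \<open>Derivatives are taken within \<open>[0,1]\<close>, hence one-sided at the endpoints; \<open>D j\<close> is the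
  \<open>j\<close>-th derivative. Values of \<open>f\<close> outside \<open>[0,1]\<close> are irrelevant throughout.\<close>

definition holder_class :: "real \<Rightarrow> real \<Rightarrow> (real \<Rightarrow> real) set" where
  "holder_class \<alpha> C = {f. \<exists>D :: nat \<Rightarrow> real \<Rightarrow> real. D 0 = f \<and>
     (\<forall>j<holder_order \<alpha>. \<forall>x\<in>{0..1}.
        (D j has_real_derivative D (Suc j) x) (at x within {0..1})) \<and>
     (\<forall>x y. 0 \<le> x \<and> x < y \<and> y \<le> 1 \<longrightarrow>
        \<bar>D (holder_order \<alpha>) x - D (holder_order \<alpha>) y\<bar>
          \<le> C * \<bar>x - y\<bar> powr (\<alpha> - real (holder_order \<alpha>)))}"

definition risk :: "'a measure \<Rightarrow> (real \<Rightarrow> 'a \<Rightarrow> real) \<Rightarrow> nat \<Rightarrow>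
    ((real \<Rightarrow> real) \<Rightarrow> real \<Rightarrow> real) \<Rightarrow> (real \<Rightarrow> real) \<Rightarrow> real \<Rightarrow> real \<Rightarrow> ennreal" where
  "risk P B n \<delta> f x0 c =
     (if c > 0 then
        ennreal (1 / (2 * c)) *
          (\<integral>\<^sup>+\<omega>. (\<integral>\<^sup>+x\<in>{x0 - c..x0 + c}.
             ennreal ((\<delta> (observation B n f \<omega>) x - f x)\<^sup>2) \<partial>lborel) \<partial>P)
      else (\<integral>\<^sup>+\<omega>. ennreal ((\<delta> (observation B n f \<omega>) x0 - f x0)\<^sup>2) \<partial>P))"

end

theory Submission imports Defs begin

text \<open>The proof compares two signals, the zero function and a single bump $g$ in the rougher class
centred at \<open>x0\<close>, and shows that an estimator which is too good at zero must be bad at $g$.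

Let $Q_0$ and $Q_g$ be the laws of the observed path. By Cauchy--Schwarz, if $Q_g$ has density $L$
with respect to $Q_0$, then $Q_g(A)^2 \le Q_0(A) \int L^2\,dQ_0$, and for the white noise model the
second moment of $L$ is $\exp(n\|g\|^2)$. This is \<open>observation_shift_bound\<close>. Suppose the risk of
the estimator at zero is at most $C n^{-r}$. By Markov's inequality the event $A$ that the estimate
is locally large, with mean square at least $\tau/4$, satisfies $Q_0(A) \le 4 C n^{-r} / \tau$, where
$\tau$ is a lower bound for the local mean square of $g$. If $16 \exp(n\|g\|^2) C n^{-r} \le \tau$,
then $Q_g(A) \le 1/2$, so under $g$ the estimate is small with probability at least one half and
misses $g$; the risk at $g$ is at least $\tau/8$. This is \<open>two_point_bound\<close>.

The logarithm comes from the choice of $g$. The bump has width $h$ and height of order $h^{\alpha_1}$,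
hence energy of order $h^{2\alpha_1+1}$. Taking $h^{2\alpha_1+1} = \kappa \log n / n$ makes
$\exp(n\|g\|^2)$ a small power of $n$. Since $r$ exceeds $2\alpha_1/(1+2\alpha_1)$, the gain $n^{-r}$
of the estimator at zero pays for this power if $\kappa$ is small. The local mean square of $g$ over
$[x_0-c_n,x_0+c_n]$ is of order $h^{2\alpha_1}\min(1,h/c_n)$, that is, up to constants
$(\log n/n)^{2\alpha_1/(1+2\alpha_1)}/\max(1,d_n(\log n)^{-1/(1+2\alpha_1)})$. The same bump thus
serves all regimes of \<open>d\<close>: this is \<open>superefficiency_lower_bound\<close>, from which the three claims follow
by elementary asymptotics. In the first claim one may assume that the second \<open>limsup\<close> is finite, which
is the hypothesis with $r = 2\alpha_2/(1+2\alpha_2)$.\<close>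

section \<open>Second moment bounds between measures\<close>

text \<open>If $\nu = L\mu$ and $\int L^2\,d\mu \le K$, this is the Cauchy--Schwarz inequality. Written without the
density, the bound passes to products and images, and no likelihood ratio on the
path space has to be constructed.\<close>

definition second_moment_bounded :: "ennreal \<Rightarrow> 'b measure \<Rightarrow> 'b measure \<Rightarrow> bool" where
  "second_moment_bounded K \<mu> \<nu> \<longleftrightarrow> sets \<nu> = sets \<mu> \<and>
     (\<forall>\<phi>\<in>borel_measurable \<mu>. (\<integral>\<^sup>+x. \<phi> x \<partial>\<nu>)\<^sup>2 \<le> K * (\<integral>\<^sup>+x. (\<phi> x)\<^sup>2 \<partial>\<mu>))"

lemma second_moment_boundedD:
  assumes "second_moment_bounded K \<mu> \<nu>" "\<phi> \<in> borel_measurable \<mu>"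
  shows "(\<integral>\<^sup>+x. \<phi> x \<partial>\<nu>)\<^sup>2 \<le> K * (\<integral>\<^sup>+x. (\<phi> x)\<^sup>2 \<partial>\<mu>)"
  using assms by (auto simp: second_moment_bounded_def)

lemma second_moment_bounded_emeasure:
  assumes b: "second_moment_bounded K \<mu> \<nu>" and A: "A \<in> sets \<mu>"
  shows "(emeasure \<nu> A)\<^sup>2 \<le> K * emeasure \<mu> A"
proof -
  have "sets \<nu> = sets \<mu>" using b by (simp add: second_moment_bounded_def)
  then have "(emeasure \<nu> A)\<^sup>2 = (\<integral>\<^sup>+x. indicator A x \<partial>\<nu>)\<^sup>2" using A by simp
  also have "\<dots> \<le> K * (\<integral>\<^sup>+x. (indicator A x)\<^sup>2 \<partial>\<mu>)"
    using A by (intro second_moment_boundedD[OF b]) auto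
  also have "(\<integral>\<^sup>+x. (indicator A x)\<^sup>2 \<partial>\<mu>) = (\<integral>\<^sup>+x. indicator A x \<partial>\<mu>)"
    by (intro nn_integral_cong) (auto simp: indicator_def)
  finally show ?thesis using A by simp
qed

lemma second_moment_bounded_distr:
  assumes b: "second_moment_bounded K \<mu> \<nu>" and T: "T \<in> measurable \<mu> N"
  shows "second_moment_bounded K (distr \<mu> N T) (distr \<nu> N T)"
proof -
  have s: "sets \<nu> = sets \<mu>" using b by (simp add: second_moment_bounded_def)
  note T [measurable]
  have T' [measurable]: "T \<in> measurable \<nu> N"
    using T measurable_cong_sets[OF s refl, of N] by simp
  show ?thesis
    unfolding second_moment_bounded_def
  proof (intro conjI ballI)
    fix \<phi> :: "'b \<Rightarrow> ennreal" assume "\<phi> \<in> borel_measurable (distr \<mu> N T)"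
    then have [measurable]: "\<phi> \<in> borel_measurable N" by simp
    have "(\<lambda>x. \<phi> (T x)) \<in> borel_measurable \<mu>" by measurable
    from second_moment_boundedD[OF b this]
    show "(\<integral>\<^sup>+x. \<phi> x \<partial>distr \<nu> N T)\<^sup>2 \<le> K * (\<integral>\<^sup>+x. (\<phi> x)\<^sup>2 \<partial>distr \<mu> N T)"
      by (simp add: nn_integral_distr)
  qed simp
qed

text \<open>Completing the square: the squared likelihood ratio of two shifted normal laws, times the
reference density, is a constant times the normal density centred at twice the shift.\<close>

lemma normal_density_square_ratio:
  assumes "\<sigma> > 0"
  shows "(normal_density a \<sigma> x / sqrt (normal_density 0 \<sigma> x))\<^sup>2 =
    exp (a\<^sup>2 / \<sigma>\<^sup>2) * normal_density (2 * a) \<sigma> x"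
proof -
  have p: "normal_density 0 \<sigma> x > 0" using assms by (rule normal_density_pos)
  have "(normal_density a \<sigma> x)\<^sup>2 = exp (a\<^sup>2 / \<sigma>\<^sup>2) * normal_density (2 * a) \<sigma> x * normal_density 0 \<sigma> x"
    using assms
    unfolding normal_density_def power2_eq_square[of "1 / _ * _"]
    by (simp add: exp_add[symmetric] field_simps power2_eq_square flip: exp_add)
  then show ?thesis using p by (simp add: power_divide less_imp_le)
qed

lemma second_moment_bounded_normal:
  assumes \<sigma>: "\<sigma> > 0"
  shows "second_moment_bounded (ennreal (exp (a\<^sup>2 / \<sigma>\<^sup>2)))
    (density lborel (normal_density 0 \<sigma>)) (density lborel (normal_density a \<sigma>))"
  unfolding second_moment_bounded_def
proof (intro conjI ballI)
  fix \<phi> :: "real \<Rightarrow> ennreal"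
  assume "\<phi> \<in> borel_measurable (density lborel (normal_density 0 \<sigma>))"
  then have [measurable]: "\<phi> \<in> borel_measurable borel" by simp
  let ?p = "normal_density 0 \<sigma>" and ?q = "normal_density a \<sigma>"
  have pos: "?p x > 0" for x using \<sigma> by (rule normal_density_pos)
  have split: "ennreal (?q x) = ennreal (sqrt (?p x)) * ennreal (?q x / sqrt (?p x))" for x
    using pos[of x] by (simp add: ennreal_mult[symmetric])
  have "(\<integral>\<^sup>+x. \<phi> x \<partial>density lborel ?q)\<^sup>2 =
      (\<integral>\<^sup>+x. (\<phi> x * ennreal (sqrt (?p x))) * ennreal (?q x / sqrt (?p x)) \<partial>lborel)\<^sup>2"
    by (simp add: nn_integral_density split mult_ac)
  also have "\<dots> \<le> (\<integral>\<^sup>+x. (\<phi> x * ennreal (sqrt (?p x)))\<^sup>2 \<partial>lborel) *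
      (\<integral>\<^sup>+x. (ennreal (?q x / sqrt (?p x)))\<^sup>2 \<partial>lborel)"
    by (rule Cauchy_Schwarz_nn_integral) measurable
  also have "(\<integral>\<^sup>+x. (\<phi> x * ennreal (sqrt (?p x)))\<^sup>2 \<partial>lborel) =
      (\<integral>\<^sup>+x. (\<phi> x)\<^sup>2 \<partial>density lborel ?p)"
    by (simp add: nn_integral_density power_mult_distrib ennreal_power mult_ac)
  also have "(\<integral>\<^sup>+x. (ennreal (?q x / sqrt (?p x)))\<^sup>2 \<partial>lborel) =
      (\<integral>\<^sup>+x. ennreal (exp (a\<^sup>2 / \<sigma>\<^sup>2)) * ennreal (normal_density (2 * a) \<sigma> x) \<partial>lborel)"
    using normal_density_square_ratio[OF \<sigma>]
    by (intro nn_integral_cong) (simp add: ennreal_power ennreal_mult[symmetric])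
  also have "\<dots> = ennreal (exp (a\<^sup>2 / \<sigma>\<^sup>2))"
    using \<sigma> by (simp add: nn_integral_cmult nn_integral_eq_integral)
  finally show "(\<integral>\<^sup>+x. \<phi> x \<partial>density lborel ?q)\<^sup>2 \<le>
      ennreal (exp (a\<^sup>2 / \<sigma>\<^sup>2)) * (\<integral>\<^sup>+x. (\<phi> x)\<^sup>2 \<partial>density lborel ?p)"
    by (simp add: mult.commute)
qed simp

text \<open>By Fubini the constants multiply: the bound for the new factor is applied to the inner
integral, after the induction hypothesis has been applied to the outer one.\<close>

lemma second_moment_bounded_PiM:
  fixes \<mu> \<nu> :: "'i \<Rightarrow> 'b measure"
  assumes "finite J"
    and prob: "\<And>i. prob_space (\<mu> i)" "\<And>i. prob_space (\<nu> i)"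
    and b: "\<And>i. second_moment_bounded (K i) (\<mu> i) (\<nu> i)"
  shows "second_moment_bounded (\<Prod>i\<in>J. K i) (PiM J \<mu>) (PiM J \<nu>)"
  using \<open>finite J\<close>
proof (induction J rule: finite_induct)
  case empty
  show ?case by (simp add: second_moment_bounded_def nn_integral_count_space_finite PiM_empty)
next
  case (insert i J)
  interpret \<mu>: product_prob_space \<mu> by (intro product_prob_spaceI prob)
  interpret \<nu>: product_prob_space \<nu> by (intro product_prob_spaceI prob)
  have s [measurable_cong]: "sets (\<nu> i) = sets (\<mu> i)" for i
    using b by (simp add: second_moment_bounded_def)
  have sP: "sets (PiM I \<nu>) = sets (PiM I \<mu>)" for I
    by (intro sets_PiM_cong refl s)
  show ?case
    unfolding second_moment_bounded_def
  proof (intro conjI ballI)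
    fix \<phi> :: "_ \<Rightarrow> ennreal" assume m [measurable]: "\<phi> \<in> borel_measurable (PiM (insert i J) \<mu>)"
    then have m': "\<phi> \<in> borel_measurable (PiM (insert i J) \<nu>)"
      using measurable_cong_sets[OF sP refl] by blast
    have upd: "(\<lambda>(x, y). x(i := y)) \<in> measurable (PiM J \<mu> \<Otimes>\<^sub>M \<mu> i) (PiM (insert i J) \<mu>)"
      using measurable_add_dim[of i J \<mu>] by simp
    have mm: "(\<lambda>(x, y). \<phi> (x(i := y))) \<in> borel_measurable (PiM J \<mu> \<Otimes>\<^sub>M \<mu> i)"
      using measurable_compose[OF upd m] by (simp add: case_prod_unfold)
    have mm\<nu>: "(\<lambda>(x, y). \<phi> (x(i := y))) \<in> borel_measurable (PiM J \<mu> \<Otimes>\<^sub>M \<nu> i)"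
      using mm by (subst measurable_cong_sets[OF sets_pair_measure_cong[OF refl s] refl])
    have my: "(\<lambda>y. \<phi> (x(i := y))) \<in> borel_measurable (\<mu> i)" if "x \<in> space (PiM J \<mu>)" for x
      using measurable_compose[OF measurable_Pair1'[OF that] mm] by simp
    have inner: "(\<lambda>x. \<integral>\<^sup>+y. \<phi> (x(i := y)) \<partial>\<nu> i) \<in> borel_measurable (PiM J \<mu>)"
      using \<nu>.sigma_finite_measures[of i] mm\<nu>
      by (intro sigma_finite_measure.borel_measurable_nn_integral) 
    have inner2: "(\<lambda>x. \<integral>\<^sup>+y. (\<phi> (x(i := y)))\<^sup>2 \<partial>\<mu> i) \<in> borel_measurable (PiM J \<mu>)"
      using \<mu>.sigma_finite_measures[of i] mm
      by (intro sigma_finite_measure.borel_measurable_nn_integral) (auto simp: case_prod_unfold)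
    have "(\<integral>\<^sup>+x. \<phi> x \<partial>PiM (insert i J) \<nu>)\<^sup>2 = (\<integral>\<^sup>+x. (\<integral>\<^sup>+y. \<phi> (x(i := y)) \<partial>\<nu> i) \<partial>PiM J \<nu>)\<^sup>2"
      using \<nu>.product_nn_integral_insert[OF insert.hyps m'] by simp
    also have "\<dots> \<le> (\<Prod>i\<in>J. K i) * (\<integral>\<^sup>+x. (\<integral>\<^sup>+y. \<phi> (x(i := y)) \<partial>\<nu> i)\<^sup>2 \<partial>PiM J \<mu>)"
      by (rule second_moment_boundedD[OF insert.IH inner])
    also have "\<dots> \<le> (\<Prod>i\<in>J. K i) * (\<integral>\<^sup>+x. K i * (\<integral>\<^sup>+y. (\<phi> (x(i := y)))\<^sup>2 \<partial>\<mu> i) \<partial>PiM J \<mu>)"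
      by (intro mult_left_mono nn_integral_mono second_moment_boundedD[OF b] my) auto
    also have "\<dots> = (\<Prod>i\<in>insert i J. K i) * (\<integral>\<^sup>+x. (\<phi> x)\<^sup>2 \<partial>PiM (insert i J) \<mu>)"
      using insert.hyps inner2
      by (simp add: nn_integral_cmult \<mu>.product_nn_integral_insert mult_ac)
    finally show "(\<integral>\<^sup>+x. \<phi> x \<partial>PiM (insert i J) \<nu>)\<^sup>2
        \<le> (\<Prod>i\<in>insert i J. K i) * (\<integral>\<^sup>+x. (\<phi> x)\<^sup>2 \<partial>PiM (insert i J) \<mu>)" .
  qed (rule sP)
qed

text \<open>The sets that can be approximated simultaneously for both measures form a sigma-algebra: a countable
union is first cut off at a finite stage, where the algebra is closed under unions.\<close>

lemma sigma_sets_approx_by_algebra: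
  assumes alg: "algebra \<Omega> G"
    and fin: "finite_measure Q0" "finite_measure Q1"
    and sets: "sets Q0 = sigma_sets \<Omega> G" "sets Q1 = sigma_sets \<Omega> G"
    and A: "A \<in> sigma_sets \<Omega> G"
  shows "\<forall>\<epsilon>>0. \<exists>C\<in>G. measure Q0 (A - C \<union> (C - A)) < \<epsilon> \<and> measure Q1 (A - C \<union> (C - A)) < \<epsilon>"
  using A
proof induction
  case (Basic a)
  then show ?case by (intro allI impI bexI[of _ a]) auto
next
  case Empty
  interpret algebra \<Omega> G by fact
  show ?case by (intro allI impI bexI[of _ "{}"]) auto
next
  case (Compl a)
  interpret algebra \<Omega> G by fact
  show ?case
  proof (intro allI impI)
    fix \<epsilon> :: real assume "\<epsilon> > 0"
    with Compl.IH obtain C where C: "C \<in> G" "measure Q0 (a - C \<union> (C - a)) < \<epsilon>"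
      "measure Q1 (a - C \<union> (C - a)) < \<epsilon>" by blast
    have "a \<subseteq> \<Omega>" using sigma_sets_into_sp[OF space_closed Compl.hyps] .
    then have "\<Omega> - a - (\<Omega> - C) \<union> (\<Omega> - C - (\<Omega> - a)) = a - C \<union> (C - a)"
      using C(1) sets_into_space by blast
    with C show "\<exists>C\<in>G. measure Q0 (\<Omega> - a - C \<union> (C - (\<Omega> - a))) < \<epsilon> \<and>
        measure Q1 (\<Omega> - a - C \<union> (C - (\<Omega> - a))) < \<epsilon>"
      by (intro bexI[of _ "\<Omega> - C"]) auto
  qed
next
  case (Union a)
  interpret algebra \<Omega> G by fact
  show ?case
  proof (intro allI impI)
    fix \<epsilon> :: real assume \<epsilon>: "\<epsilon> > 0"
    have fin_approx: "\<exists>C\<in>G. measure Q0 ((\<Union>i<n. a i) - C \<union> (C - (\<Union>i<n. a i))) < \<epsilon> / 2 \<and>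
        measure Q1 ((\<Union>i<n. a i) - C \<union> (C - (\<Union>i<n. a i))) < \<epsilon> / 2" for n :: nat
    proof -
      define \<delta> where "\<delta> = \<epsilon> / (2 * (real n + 1))"
      have \<delta>: "\<delta> > 0" using \<epsilon> by (simp add: \<delta>_def)
      have "\<forall>i. \<exists>C\<in>G. measure Q0 (a i - C \<union> (C - a i)) < \<delta> \<and> measure Q1 (a i - C \<union> (C - a i)) < \<delta>"
        using Union.IH \<delta> by blast
      then obtain C where C: "\<And>i. C i \<in> G" "\<And>i. measure Q0 (a i - C i \<union> (C i - a i)) < \<delta>"
        "\<And>i. measure Q1 (a i - C i \<union> (C i - a i)) < \<delta>" by metis
      have CG: "(\<Union>i<n. C i) \<in> G" using C(1) by auto
      have CS: "C i \<in> sigma_sets \<Omega> G" for i using C(1) by (auto intro: sigma_sets.Basic)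
      have key: "measure Q ((\<Union>i<n. a i) - (\<Union>i<n. C i) \<union> ((\<Union>i<n. C i) - (\<Union>i<n. a i))) < \<epsilon> / 2"
        if Q: "finite_measure Q" "sets Q = sigma_sets \<Omega> G"
          "\<And>i. measure Q (a i - C i \<union> (C i - a i)) < \<delta>" for Q
      proof -
        interpret Q: finite_measure Q by fact
        have ms: "a i - C i \<union> (C i - a i) \<in> sets Q" for i
          using Union.hyps CS by (intro sets.Un sets.Diff) (auto simp: Q)
        have "measure Q ((\<Union>i<n. a i) - (\<Union>i<n. C i) \<union> ((\<Union>i<n. C i) - (\<Union>i<n. a i)))
            \<le> measure Q (\<Union>i<n. a i - C i \<union> (C i - a i))"
          using ms by (intro Q.finite_measure_mono) auto
        also have "\<dots> \<le> (\<Sum>i<n. measure Q (a i - C i \<union> (C i - a i)))"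
          using ms by (intro Q.finite_measure_subadditive_finite) auto
        also have "\<dots> \<le> (\<Sum>i<n. \<delta>)" by (intro sum_mono less_imp_le Q)
        also have "\<dots> < \<epsilon> / 2" using \<epsilon> by (simp add: \<delta>_def field_simps)
        finally show ?thesis .
      qed
      show ?thesis
        using CG key[OF fin(1) sets(1) C(2)] key[OF fin(2) sets(2) C(3)] by blast
    qed
    have tail: "(\<lambda>n. measure Q ((\<Union>i. a i) - (\<Union>i<n. a i))) \<longlonglongrightarrow> 0"
      if Q: "finite_measure Q" "sets Q = sigma_sets \<Omega> G" for Q
    proof -
      interpret Q: finite_measure Q by fact
      have ms: "a i \<in> sets Q" for i using Union.hyps by (auto simp: Q)
      have "(\<lambda>n. measure Q ((\<Union>i. a i) - (\<Union>i<n. a i))) \<longlonglongrightarrow>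
          measure Q (\<Inter>n. (\<Union>i. a i) - (\<Union>i<n. a i))"
        using ms by (intro Q.finite_Lim_measure_decseq) (auto simp: decseq_def intro: less_le_trans)
      also have "(\<Inter>n. (\<Union>i. a i) - (\<Union>i<n. a i)) = {}" by auto
      finally show ?thesis by simp
    qed
    have "\<forall>\<^sub>F n in sequentially. measure Q0 ((\<Union>i. a i) - (\<Union>i<n. a i)) < \<epsilon> / 2 \<and>
        measure Q1 ((\<Union>i. a i) - (\<Union>i<n. a i)) < \<epsilon> / 2"
      using order_tendstoD(2)[OF tail[OF fin(1) sets(1)], of "\<epsilon> / 2"]
        order_tendstoD(2)[OF tail[OF fin(2) sets(2)], of "\<epsilon> / 2"] \<epsilon> by (auto elim: eventually_elim2)
    then obtain n where n: "measure Q0 ((\<Union>i. a i) - (\<Union>i<n. a i)) < \<epsilon> / 2"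
        "measure Q1 ((\<Union>i. a i) - (\<Union>i<n. a i)) < \<epsilon> / 2"
      by (auto simp: eventually_sequentially)
    from fin_approx[of n] obtain C where C: "C \<in> G"
        "measure Q0 ((\<Union>i<n. a i) - C \<union> (C - (\<Union>i<n. a i))) < \<epsilon> / 2"
        "measure Q1 ((\<Union>i<n. a i) - C \<union> (C - (\<Union>i<n. a i))) < \<epsilon> / 2" by blast
    have key: "measure Q ((\<Union>i. a i) - C \<union> (C - (\<Union>i. a i))) < \<epsilon>"
      if Q: "finite_measure Q" "sets Q = sigma_sets \<Omega> G"
        "measure Q ((\<Union>i. a i) - (\<Union>i<n. a i)) < \<epsilon> / 2"
        "measure Q ((\<Union>i<n. a i) - C \<union> (C - (\<Union>i<n. a i))) < \<epsilon> / 2" for Q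
    proof -
      interpret Q: finite_measure Q by fact
      have ms: "a i \<in> sets Q" "C \<in> sets Q" for i
        using Union.hyps C(1) by (auto simp: Q intro: sigma_sets.Basic)
      have "measure Q ((\<Union>i. a i) - C \<union> (C - (\<Union>i. a i))) \<le>
          measure Q (((\<Union>i. a i) - (\<Union>i<n. a i)) \<union> ((\<Union>i<n. a i) - C \<union> (C - (\<Union>i<n. a i))))"
        using ms by (intro Q.finite_measure_mono) auto
      also have "\<dots> \<le> measure Q ((\<Union>i. a i) - (\<Union>i<n. a i)) +
          measure Q ((\<Union>i<n. a i) - C \<union> (C - (\<Union>i<n. a i)))"
        using ms by (intro measure_Un_le) auto
      finally show ?thesis using Q by simp
    qed
    show "\<exists>C\<in>G. measure Q0 (\<Union> (range a) - C \<union> (C - \<Union> (range a))) < \<epsilon> \<and>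
        measure Q1 (\<Union> (range a) - C \<union> (C - \<Union> (range a))) < \<epsilon>"
      using key[OF fin(1) sets(1) n(1) C(2)] key[OF fin(2) sets(2) n(2) C(3)] C(1) by auto
  qed
qed

text \<open>The inequality is not linear in the two measures, so the sets satisfying it need not form a Dynkin
system; but both sides are continuous under the approximation by sets of the algebra.\<close>

lemma measure_square_bound_from_algebra:
  assumes alg: "algebra \<Omega> G"
    and fin: "finite_measure Q0" "finite_measure Q1"
    and sets: "sets Q0 = sigma_sets \<Omega> G" "sets Q1 = sigma_sets \<Omega> G"
    and G: "\<And>C. C \<in> G \<Longrightarrow> (measure Q1 C)\<^sup>2 \<le> K * measure Q0 C"
    and A: "A \<in> sigma_sets \<Omega> G"
  shows "(measure Q1 A)\<^sup>2 \<le> K * measure Q0 A"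
proof -
  interpret Q0: finite_measure Q0 by fact
  interpret Q1: finite_measure Q1 by fact
  have "\<forall>m. \<exists>C\<in>G. measure Q0 (A - C \<union> (C - A)) < 1 / Suc m \<and> measure Q1 (A - C \<union> (C - A)) < 1 / Suc m"
    using sigma_sets_approx_by_algebra[OF alg fin sets A] by simp
  then obtain C where C: "\<And>m. C m \<in> G" "\<And>m. measure Q0 (A - C m \<union> (C m - A)) < 1 / Suc m"
      "\<And>m. measure Q1 (A - C m \<union> (C m - A)) < 1 / Suc m" by metis
  have conv: "(\<lambda>m. measure Q (C m)) \<longlonglongrightarrow> measure Q A"
    if Q: "finite_measure Q" "sets Q = sigma_sets \<Omega> G"
      "\<And>m. measure Q (A - C m \<union> (C m - A)) < 1 / Suc m" for Q
  proof -
    interpret Q: finite_measure Q by fact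
    have ms: "A \<in> sets Q" "C m \<in> sets Q" for m
      using A C(1) by (auto simp: Q intro: sigma_sets.Basic)
    have "\<bar>measure Q (C m) - measure Q A\<bar> \<le> measure Q (A - C m \<union> (C m - A))" for m
    proof -
      have "measure Q (C m) \<le> measure Q (A \<union> (A - C m \<union> (C m - A)))"
        "measure Q A \<le> measure Q (C m \<union> (A - C m \<union> (C m - A)))"
        using ms by (auto intro!: Q.finite_measure_mono)
      moreover have "measure Q (A \<union> (A - C m \<union> (C m - A))) \<le> measure Q A + measure Q (A - C m \<union> (C m - A))"
        "measure Q (C m \<union> (A - C m \<union> (C m - A))) \<le> measure Q (C m) + measure Q (A - C m \<union> (C m - A))"
        using ms by (auto intro!: measure_Un_le)
      ultimately show ?thesis by linarith
    qed
    then have "\<bar>measure Q (C m) - measure Q A\<bar> \<le> 1 / Suc m" for m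
      using Q(3)[of m] by (meson le_less_trans less_imp_le)
    then have "(\<lambda>m. measure Q (C m) - measure Q A) \<longlonglongrightarrow> 0"
      by (intro Lim_null_comparison[OF _ LIMSEQ_inverse_real_of_nat]) (simp add: inverse_eq_divide)
    then show ?thesis by (simp add: LIM_zero_iff)
  qed
  have "(\<lambda>m. (measure Q1 (C m))\<^sup>2) \<longlonglongrightarrow> (measure Q1 A)\<^sup>2"
    by (intro tendsto_power conv fin sets C)
  moreover have "(\<lambda>m. K * measure Q0 (C m)) \<longlonglongrightarrow> K * measure Q0 A"
    by (intro tendsto_mult_left conv fin sets C)
  ultimately show ?thesis
    by (rule LIMSEQ_le) (use C(1) G in auto)
qed

lemma measure_square_bound_PiM:
  fixes M :: "'i \<Rightarrow> 'b measure"
  assumes prob: "prob_space Q0" "prob_space Q1"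
    and sets: "sets Q0 = sets (PiM I M)" "sets Q1 = sets (PiM I M)"
    and cyl: "\<And>J X. finite J \<Longrightarrow> J \<subseteq> I \<Longrightarrow> X \<in> sets (PiM J M) \<Longrightarrow>
      (measure Q1 (prod_emb I M J X))\<^sup>2 \<le> K * measure Q0 (prod_emb I M J X)"
    and A: "A \<in> sets (PiM I M)"
  shows "(measure Q1 A)\<^sup>2 \<le> K * measure Q0 A"
proof -
  interpret Q0: prob_space Q0 by fact
  interpret Q1: prob_space Q1 by fact
  \<comment> \<open>The projective family of the marginals of \<open>Q0\<close> serves only to have the cylinder sets as a
      generating algebra of the product sigma-algebra.\<close>
  have mr: "(\<lambda>f. restrict f J) \<in> measurable Q0 (PiM J M)" if "J \<subseteq> I" for J
    using measurable_restrict_subset[OF that, of M] measurable_cong_sets[OF sets(1) refl] by blast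
  interpret pf: projective_family I "\<lambda>J. distr Q0 (PiM J M) (\<lambda>f. restrict f J)" M
  proof (rule projective_family.intro)
    fix J H :: "'i set" assume JH: "J \<subseteq> H" "H \<subseteq> I"
    have "distr (distr Q0 (PiM H M) (\<lambda>f. restrict f H)) (PiM J M) (\<lambda>f. restrict f J) =
        distr Q0 (PiM J M) ((\<lambda>f. restrict f J) \<circ> (\<lambda>f. restrict f H))"
      using JH by (intro distr_distr measurable_restrict_subset mr)
    also have "(\<lambda>f. restrict f J) \<circ> (\<lambda>f. restrict f H) = (\<lambda>f. restrict f J)"
      using JH by (auto simp: fun_eq_iff restrict_def)
    finally show "distr Q0 (PiM J M) (\<lambda>f. restrict f J) =
      distr (distr Q0 (PiM H M) (\<lambda>f. restrict f H)) (PiM J M) (\<lambda>f. restrict f J)" by (rule sym)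
  next
    fix J :: "'i set" assume "finite J" "J \<subseteq> I"
    then show "prob_space (distr Q0 (PiM J M) (\<lambda>f. restrict f J))"
      by (intro Q0.prob_space_distr mr)
  qed
  show ?thesis
  proof (rule measure_square_bound_from_algebra[OF pf.algebra_generator])
    show "finite_measure Q0" "finite_measure Q1" by unfold_locales
    show "(measure Q1 C)\<^sup>2 \<le> K * measure Q0 C" if "C \<in> pf.generator" for C
      using that by (auto elim!: pf.generator.cases intro: cyl)
  qed (use sets A pf.sets_PiM_generator in auto)
qed

section \<open>Shifting the signal of a Brownian observation\<close>

lemma second_moment_bounded_mono:
  assumes "second_moment_bounded K \<mu> \<nu>" "K \<le> K'"
  shows "second_moment_bounded K' \<mu> \<nu>"
  using assms unfolding second_moment_bounded_def
  by (meson mult_right_mono order_trans zero_le)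

lemma set_integrable_subinterval:
  fixes g :: "real \<Rightarrow> real"
  assumes "continuous_on {0..1} g" "0 \<le> s" "t \<le> 1"
  shows "set_integrable lborel {s<..t} g"
  using borel_integrable_atLeastAtMost'[OF assms(1)]
  by (rule set_integrable_subset) (use assms in auto)

lemma set_integral_diff_Ioc:
  fixes g :: "real \<Rightarrow> real"
  assumes g: "continuous_on {0..1} g" and st: "0 \<le> s" "s \<le> t" "t \<le> 1"
  shows "(LINT x:{0..t}|lborel. g x) - (LINT x:{0..s}|lborel. g x) = (LINT x:{s<..t}|lborel. g x)"
proof -
  have "{0..t} = {0..s} \<union> {s<..t}" using st by auto
  moreover have "set_integrable lborel {0..s} g"
    using borel_integrable_atLeastAtMost'[OF g] by (rule set_integrable_subset) (use st in auto)
  moreover have "set_integrable lborel {s<..t} g"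
    using set_integrable_subinterval[OF g] st by auto
  moreover have "{0..s} \<inter> {s<..t} = {}" by auto
  ultimately show ?thesis
    by (simp add: set_integral_Un)
qed

lemma set_integral_singleton_lborel: "(LINT x:{a..a}|lborel. f x) = (0::real)" for a :: real
  unfolding set_lebesgue_integral_def
  by (intro integral_eq_zero_AE eventually_mono[OF AE_lborel_singleton[of a]]) auto

text \<open>Expanding the integral of $(g-m)^2$, where $m$ is the mean of $g$ over the interval.\<close>

lemma set_integral_square_le:
  fixes g :: "real \<Rightarrow> real"
  assumes g: "continuous_on {0..1} g" and st: "0 \<le> s" "s < t" "t \<le> 1"
  shows "(LINT x:{s<..t}|lborel. g x)\<^sup>2 / (t - s) \<le> (LINT x:{s<..t}|lborel. (g x)\<^sup>2)"
proof -
  define m where "m = (LINT x:{s<..t}|lborel. g x) / (t - s)"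
  have I1: "set_integrable lborel {s<..t} g"
    using set_integrable_subinterval[OF g] st by auto
  have I2: "set_integrable lborel {s<..t} (\<lambda>x. (g x)\<^sup>2)"
    using set_integrable_subinterval[of "\<lambda>x. (g x)\<^sup>2" s t] g st by (auto intro: continuous_intros)
  have I0: "set_integrable lborel {s<..t} (\<lambda>x. m\<^sup>2)"
    using set_integrable_subinterval[of "\<lambda>x. m\<^sup>2" s t] st by auto
  have m0: "(LINT x:{s<..t}|lborel. m\<^sup>2) = m\<^sup>2 * (t - s)"
    using st by (simp add: set_lebesgue_integral_def)
  have "0 \<le> (LINT x:{s<..t}|lborel. (g x - m)\<^sup>2)"
    unfolding set_lebesgue_integral_def by (intro integral_nonneg_AE) (auto simp: indicator_def)
  also have "\<dots> = (LINT x:{s<..t}|lborel. (g x)\<^sup>2 - 2 * m * g x + m\<^sup>2)"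
    by (simp add: power2_diff algebra_simps)
  also have "\<dots> = (LINT x:{s<..t}|lborel. (g x)\<^sup>2) - 2 * m * (LINT x:{s<..t}|lborel. g x) + m\<^sup>2 * (t - s)"
    using I0 I1 I2 by (simp add: set_integral_add set_integral_diff m0)
  also have "\<dots> = (LINT x:{s<..t}|lborel. (g x)\<^sup>2) - (LINT x:{s<..t}|lborel. g x)\<^sup>2 / (t - s)"
    using st by (simp add: m_def power_divide power2_eq_square[of "t - s"]) (simp add: power2_eq_square)
  finally show ?thesis by simp
qed

text \<open>Adding both endpoints gives at least one increment and lets the sum of the bounds
over the increments be the integral over all of $[0,1]$.\<close>

lemma finite_set_as_grid:
  fixes J :: "real set"
  assumes "finite J" "J \<subseteq> {0..1}"
  obtains m :: nat and \<tau> :: "nat \<Rightarrow> real"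
  where "m > 0" "\<tau> 0 = 0" "\<tau> m = 1" "\<And>i j. i < j \<Longrightarrow> j \<le> m \<Longrightarrow> \<tau> i < \<tau> j" "J \<subseteq> \<tau> ` {..m}"
proof -
  define L where "L = sorted_list_of_set (J \<union> {0, 1})"
  have fin: "finite (J \<union> {0, 1})" using assms by auto
  have set: "set L = J \<union> {0, 1}" unfolding L_def using fin by (simp del: Un_insert_right)
  have mono: "L ! i < L ! j" if "i < j" "j < length L" for i j
    using that sorted_wrt_nth_less[of "(<)" L i j] by (simp add: L_def)
  obtain k where k: "k < length L" "L ! k = 0"
    using set by (metis UnCI in_set_conv_nth insertI1)
  obtain l where l: "l < length L" "L ! l = 1"
    using set by (metis UnCI in_set_conv_nth insertI1 insertI2)
  have in01: "L ! i \<in> {0..1}" if "i < length L" for i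
    using nth_mem[OF that] assms unfolding set by auto
  have "0 < length L" using k by linarith
  then have "k = 0" using mono[of 0 k] k in01[of 0] by (cases "k = 0") auto
  have "l = length L - 1"
    using \<open>0 < length L\<close> mono[of l "length L - 1"] l in01[of "length L - 1"] by (cases "l < length L - 1") auto
  have "k \<noteq> l" using k l by auto
  have "J \<subseteq> (!) L ` {..length L - 1}"
  proof
    fix x assume "x \<in> J"
    then have "x \<in> set L" using set by auto
    then obtain i where "i < length L" "x = L ! i" by (metis in_set_conv_nth)
    then show "x \<in> (!) L ` {..length L - 1}" by auto
  qed
  then show thesis
    using k l \<open>k = 0\<close> \<open>l = _\<close> \<open>k \<noteq> l\<close>
    by (intro that[of "length L - 1" "(!) L"] mono) auto
qed

context standard_brownian_motion
begin

lemma observation_measurable: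
  "observation B n f \<in> measurable P (\<Pi>\<^sub>M t\<in>{0..1}. borel)"
  unfolding observation_def[abs_def]
  using measurable_B by (intro measurable_restrict) auto

lemma prob_space_observation: "prob_space (distr P (\<Pi>\<^sub>M t\<in>{0..1}. borel) (observation B n f))"
  by (rule prob_space_distr[OF observation_measurable])

lemma distr_increments:
  fixes \<tau> :: "nat \<Rightarrow> real" and F :: "real \<Rightarrow> real"
  assumes n: "n > 0" and m: "m > 0"
    and \<tau>: "\<tau> 0 \<ge> 0" "\<tau> m \<le> 1" "\<And>i j. i < j \<Longrightarrow> j \<le> m \<Longrightarrow> \<tau> i < \<tau> j"
  shows "distr P (\<Pi>\<^sub>M i\<in>{..<m}. borel)
      (\<lambda>\<omega>. \<lambda>i\<in>{..<m}. F (\<tau> (Suc i)) - F (\<tau> i) + 1 / sqrt (real n) * (B (\<tau> (Suc i)) \<omega> - B (\<tau> i) \<omega>)) =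
    (\<Pi>\<^sub>M i\<in>{..<m}. density lborel
      (normal_density (F (\<tau> (Suc i)) - F (\<tau> i)) (sqrt ((\<tau> (Suc i) - \<tau> i) / real n))))"
proof -
  let ?Y = "\<lambda>i \<omega>. F (\<tau> (Suc i)) - F (\<tau> i) + 1 / sqrt (real n) * (B (\<tau> (Suc i)) \<omega> - B (\<tau> i) \<omega>)"
  have in01: "\<tau> i \<in> {0..1}" if "i \<le> m" for i
    using \<tau>(1,2) \<tau>(3)[of 0 i] \<tau>(3)[of i m] that by (cases "i = 0"; cases "i = m") fastforce+
  have rv: "?Y i \<in> borel_measurable P" if "i < m" for i
    using that measurable_B[OF in01, of i] measurable_B[OF in01, of "Suc i"] by simp
  have "indep_vars (\<lambda>_. borel) (\<lambda>i. (\<lambda>x. F (\<tau> (Suc i)) - F (\<tau> i) + 1 / sqrt (real n) * x) \<circ>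
      (\<lambda>\<omega>. B (\<tau> (Suc i)) \<omega> - B (\<tau> i) \<omega>)) {..<m}"
    using \<tau> by (intro indep_vars_compose[OF B_indep]) auto
  then have ind: "indep_vars (\<lambda>_. borel) ?Y {..<m}" by (simp add: comp_def)
  have "distr P borel (?Y i) = density lborel
      (normal_density (F (\<tau> (Suc i)) - F (\<tau> i)) (sqrt ((\<tau> (Suc i) - \<tau> i) / real n)))"
    if i: "i < m" for i
  proof -
    have lt: "\<tau> i < \<tau> (Suc i)" using \<tau>(3)[of i "Suc i"] i by auto
    have "distributed P lborel (?Y i) (normal_density (F (\<tau> (Suc i)) - F (\<tau> i) + 1 / sqrt (real n) * 0)
        (\<bar>1 / sqrt (real n)\<bar> * sqrt (\<tau> (Suc i) - \<tau> i)))"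
      using lt n in01[of i] in01[of "Suc i"] i by (intro normal_density_affine B_increment) auto
    then have "distr P lborel (?Y i) = density lborel
      (normal_density (F (\<tau> (Suc i)) - F (\<tau> i)) (sqrt ((\<tau> (Suc i) - \<tau> i) / real n)))"
      by (simp add: distributed_distr_eq_density real_sqrt_divide)
    moreover have "distr P lborel (?Y i) = distr P borel (?Y i)" by (intro distr_cong) auto
    ultimately show ?thesis by simp
  qed
  moreover have "distr P (\<Pi>\<^sub>M i\<in>{..<m}. borel) (\<lambda>\<omega>. \<lambda>i\<in>{..<m}. ?Y i \<omega>) = (\<Pi>\<^sub>M i\<in>{..<m}. distr P borel (?Y i))"
    using m rv ind by (subst indep_vars_iff_distr_eq_PiM'[symmetric]) auto
  ultimately show ?thesis
    using PiM_cong[OF refl, of "{..<m}" "\<lambda>i. distr P borel (?Y i)"] by fastforce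
qed

text \<open>An increment of the observation over a cell of length $\Delta$ has variance $\Delta/n$ and mean
$a = \int g$ over the cell, so it contributes $\exp(n a^2/\Delta)$; since $a^2/\Delta$ is at most the
integral of $g^2$ over the cell, the product over the cells is at most $\exp(n\int_0^1 g^2)$.\<close>

lemma increments_second_moment_bounded:
  fixes \<tau> :: "nat \<Rightarrow> real" and g :: "real \<Rightarrow> real"
  assumes n: "n > 0" and g: "continuous_on {0..1} g"
    and \<tau>: "\<tau> 0 = 0" "\<tau> m = 1" "\<And>i j. i < j \<Longrightarrow> j \<le> m \<Longrightarrow> \<tau> i < \<tau> j"
  defines "F \<equiv> \<lambda>t. LINT x:{0..t}|lborel. g x"
  shows "second_moment_bounded (ennreal (exp (real n * (LINT x:{0..1}|lborel. (g x)\<^sup>2))))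
    (\<Pi>\<^sub>M i\<in>{..<m}. density lborel (normal_density 0 (sqrt ((\<tau> (Suc i) - \<tau> i) / real n))))
    (\<Pi>\<^sub>M i\<in>{..<m}. density lborel
      (normal_density (F (\<tau> (Suc i)) - F (\<tau> i)) (sqrt ((\<tau> (Suc i) - \<tau> i) / real n))))"
proof -
  define G where "G = (\<lambda>t. LINT x:{0..t}|lborel. (g x)\<^sup>2)"
  \<comment> \<open>Outside the index set the standard deviation is set to 1, so that every factor is a
      probability measure.\<close>
  define \<sigma> where "\<sigma> = (\<lambda>i. if i < m then sqrt ((\<tau> (Suc i) - \<tau> i) / real n) else 1)"
  define a where "a = (\<lambda>i. F (\<tau> (Suc i)) - F (\<tau> i))"
  have \<sigma>: "\<sigma> i > 0" for i using \<tau>(3)[of i "Suc i"] n by (auto simp: \<sigma>_def)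
  have le: "(a i)\<^sup>2 / (\<sigma> i)\<^sup>2 \<le> real n * (G (\<tau> (Suc i)) - G (\<tau> i))" if i: "i < m" for i
  proof -
    have lt: "\<tau> i < \<tau> (Suc i)" using \<tau>(3)[of i "Suc i"] i by auto
    have b: "0 \<le> \<tau> i" "\<tau> (Suc i) \<le> 1"
      using \<tau>(1,2) \<tau>(3)[of 0 i] \<tau>(3)[of "Suc i" m] i by (cases "i = 0"; cases "Suc i = m"; fastforce)+
    have g2: "continuous_on {0..1} (\<lambda>x. (g x)\<^sup>2)" using g by (intro continuous_intros)
    have "(a i)\<^sup>2 / (\<sigma> i)\<^sup>2 = real n * ((a i)\<^sup>2 / (\<tau> (Suc i) - \<tau> i))"
      using lt i n by (simp add: \<sigma>_def)
    also have "\<dots> \<le> real n * (G (\<tau> (Suc i)) - G (\<tau> i))"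
      using set_integral_diff_Ioc[OF g b(1) less_imp_le[OF lt] b(2)]
        set_integral_diff_Ioc[OF g2 b(1) less_imp_le[OF lt] b(2)]
        set_integral_square_le[OF g b(1) lt b(2)]
      by (intro mult_left_mono) (auto simp: a_def F_def G_def)
    finally show ?thesis .
  qed
  have "(\<Sum>i<m. (a i)\<^sup>2 / (\<sigma> i)\<^sup>2) \<le> (\<Sum>i<m. real n * (G (\<tau> (Suc i)) - G (\<tau> i)))"
    using le by (intro sum_mono) auto
  also have "\<dots> = real n * (G 1 - G 0)"
    using sum_lessThan_telescope[of "\<lambda>i. G (\<tau> i)" m] \<tau>(1,2) by (simp add: sum_distrib_left[symmetric])
  also have "G 0 = 0" by (simp add: G_def set_integral_singleton_lborel del: atLeastAtMost_singleton)
  finally have K: "(\<Prod>i<m. ennreal (exp ((a i)\<^sup>2 / (\<sigma> i)\<^sup>2))) \<le> ennreal (exp (real n * G 1))"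
    by (simp add: prod_ennreal exp_sum[symmetric])
  have "second_moment_bounded (\<Prod>i<m. ennreal (exp ((a i)\<^sup>2 / (\<sigma> i)\<^sup>2)))
    (\<Pi>\<^sub>M i\<in>{..<m}. density lborel (normal_density 0 (\<sigma> i)))
    (\<Pi>\<^sub>M i\<in>{..<m}. density lborel (normal_density (a i) (\<sigma> i)))"
    using \<sigma> by (intro second_moment_bounded_PiM second_moment_bounded_normal prob_space_normal_density) auto
  from second_moment_bounded_mono[OF this K]
  moreover have "(\<Pi>\<^sub>M i\<in>{..<m}. density lborel (normal_density (b i) (\<sigma> i))) =
      (\<Pi>\<^sub>M i\<in>{..<m}. density lborel (normal_density (b i) (sqrt ((\<tau> (Suc i) - \<tau> i) / real n))))" for b
    by (intro PiM_cong) (simp_all add: \<sigma>_def)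
  ultimately show ?thesis by (simp add: a_def G_def)
qed

text \<open>Every coordinate of the path is almost surely the sum of the increments to its left, because the path
starts at zero. So a finite-dimensional marginal of the path is the image of
the law of the increments under a map that does not depend on the signal.\<close>

lemma distr_restrict_observation:
  fixes \<tau> :: "nat \<Rightarrow> real" and f :: "real \<Rightarrow> real"
  assumes J: "J \<subseteq> \<tau> ` {..m}"
    and \<tau>: "\<tau> 0 = 0" "\<tau> m = 1" "\<And>i j. i < j \<Longrightarrow> j \<le> m \<Longrightarrow> \<tau> i < \<tau> j"
  defines "F \<equiv> \<lambda>t. LINT x:{0..t}|lborel. f x"
  shows "distr P (\<Pi>\<^sub>M t\<in>J. borel) (\<lambda>\<omega>. restrict (observation B n f \<omega>) J) =
    distr (distr P (\<Pi>\<^sub>M i\<in>{..<m}. borel)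
      (\<lambda>\<omega>. \<lambda>i\<in>{..<m}. F (\<tau> (Suc i)) - F (\<tau> i) + 1 / sqrt (real n) * (B (\<tau> (Suc i)) \<omega> - B (\<tau> i) \<omega>)))
      (\<Pi>\<^sub>M t\<in>J. borel) (\<lambda>y. \<lambda>t\<in>J. \<Sum>i | i < m \<and> \<tau> (Suc i) \<le> t. y i)"
proof -
  let ?Y = "\<lambda>i \<omega>. F (\<tau> (Suc i)) - F (\<tau> i) + 1 / sqrt (real n) * (B (\<tau> (Suc i)) \<omega> - B (\<tau> i) \<omega>)"
  let ?S = "\<lambda>y. \<lambda>t\<in>J. \<Sum>i | i < m \<and> \<tau> (Suc i) \<le> t. y i"
  have in01: "\<tau> i \<in> {0..1}" if "i \<le> m" for i
    using \<tau>(1,2) \<tau>(3)[of 0 i] \<tau>(3)[of i m] that by (cases "i = 0"; cases "i = m") fastforce+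
  have J01: "J \<subseteq> {0..1}" using J in01 by blast
  have F0: "F 0 = 0"
    by (simp add: F_def set_integral_singleton_lborel del: atLeastAtMost_singleton)
  have mY: "(\<lambda>\<omega>. \<lambda>i\<in>{..<m}. ?Y i \<omega>) \<in> measurable P (\<Pi>\<^sub>M i\<in>{..<m}. borel)"
  proof (intro measurable_restrict)
    fix i assume "i \<in> {..<m}"
    then show "?Y i \<in> borel_measurable P"
      using measurable_B[OF in01, of i] measurable_B[OF in01, of "Suc i"] by simp
  qed
  have mS: "?S \<in> measurable (\<Pi>\<^sub>M i\<in>{..<m}. borel) (\<Pi>\<^sub>M t\<in>J. (borel :: real measure))"
    by (intro measurable_restrict borel_measurable_sum) auto
  have eq: "AE \<omega> in P. restrict (observation B n f \<omega>) J = ?S (\<lambda>i\<in>{..<m}. ?Y i \<omega>)"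
    using B_zero
  proof eventually_elim
    case (elim \<omega>)
    show ?case
    proof
      fix t
      show "restrict (observation B n f \<omega>) J t = ?S (\<lambda>i\<in>{..<m}. ?Y i \<omega>) t"
      proof (cases "t \<in> J")
        case True
        then obtain k where k: "k \<le> m" "t = \<tau> k" using J by auto
        have "{i. i < m \<and> \<tau> (Suc i) \<le> t} = {..<k}"
        proof -
          have "\<tau> (Suc i) \<le> \<tau> k \<longleftrightarrow> i < k" if "i < m" for i
            using \<tau>(3)[of k "Suc i"] \<tau>(3)[of "Suc i" k] that k
            by (cases "Suc i" k rule: linorder_cases) auto
          then show ?thesis using k by auto
        qed
        then have "?S (\<lambda>i\<in>{..<m}. ?Y i \<omega>) t = (\<Sum>i<k. ?Y i \<omega>)"
          using True k by (auto intro!: sum.cong)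
        also have "\<dots> = (\<Sum>i<k. F (\<tau> (Suc i)) - F (\<tau> i)) +
            1 / sqrt (real n) * (\<Sum>i<k. B (\<tau> (Suc i)) \<omega> - B (\<tau> i) \<omega>)"
          by (simp add: sum.distrib sum_distrib_left sum_divide_distrib)
        also have "\<dots> = F t + 1 / sqrt (real n) * B t \<omega>"
          using sum_lessThan_telescope[of "\<lambda>i. F (\<tau> i)" k]
            sum_lessThan_telescope[of "\<lambda>i. B (\<tau> i) \<omega>" k] \<tau>(1) k elim F0 by simp
        finally show ?thesis using True J01 by (auto simp: observation_def F_def)
      qed simp
    qed
  qed
  have mo: "(\<lambda>\<omega>. restrict (observation B n f \<omega>) J) \<in> measurable P (\<Pi>\<^sub>M t\<in>J. borel)"
    by (rule measurable_compose[OF observation_measurable measurable_restrict_subset[OF J01]])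
  have "distr P (\<Pi>\<^sub>M t\<in>J. borel) (\<lambda>\<omega>. restrict (observation B n f \<omega>) J) =
    distr P (\<Pi>\<^sub>M t\<in>J. borel) (?S \<circ> (\<lambda>\<omega>. \<lambda>i\<in>{..<m}. ?Y i \<omega>))"
    using eq by (intro distr_cong_AE refl mo measurable_comp[OF mY mS]) (simp add: comp_def)
  then show ?thesis unfolding distr_distr[OF mS mY] .
qed

text \<open>The part of the Cameron--Martin theorem needed for testing. On cylinder sets it is the
Gaussian product bound, whose constant does not depend on the grid; it therefore extends to
all events of the path space.\<close>

theorem observation_shift_bound:
  assumes n: "n > 0" and g: "continuous_on {0..1} g"
    and A: "A \<in> sets (\<Pi>\<^sub>M t\<in>{0..1}. borel)"
  shows "(measure (distr P (\<Pi>\<^sub>M t\<in>{0..1}. borel) (observation B n g)) A)\<^sup>2 \<le>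
    exp (real n * (LINT x:{0..1}|lborel. (g x)\<^sup>2)) *
      measure (distr P (\<Pi>\<^sub>M t\<in>{0..1}. borel) (observation B n (\<lambda>_. 0))) A"
proof (rule measure_square_bound_PiM[OF prob_space_observation prob_space_observation _ _ _ A])
  fix J and X :: "(real \<Rightarrow> real) set"
  assume J: "finite J" "J \<subseteq> {0..1}" and X: "X \<in> sets (\<Pi>\<^sub>M t\<in>J. borel)"
  let ?I = "LINT x:{0..1}|lborel. (g x)\<^sup>2"
  obtain m :: nat and \<tau> :: "nat \<Rightarrow> real"
    where m: "m > 0" and \<tau>: "\<tau> 0 = 0" "\<tau> m = 1" "\<And>i j. i < j \<Longrightarrow> j \<le> m \<Longrightarrow> \<tau> i < \<tau> j"
      and J\<tau>: "J \<subseteq> \<tau> ` {..m}"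
    using finite_set_as_grid[OF J] by blast
  let ?D = "\<lambda>f. distr P (\<Pi>\<^sub>M t\<in>J. borel) (\<lambda>\<omega>. restrict (observation B n f \<omega>) J)"
  let ?S = "\<lambda>y :: nat \<Rightarrow> real. \<lambda>t\<in>J. \<Sum>i | i < m \<and> \<tau> (Suc i) \<le> t. y i"
  have law: "?D f = distr (\<Pi>\<^sub>M i\<in>{..<m}. density lborel
      (normal_density ((LINT x:{0..\<tau> (Suc i)}|lborel. f x) - (LINT x:{0..\<tau> i}|lborel. f x))
         (sqrt ((\<tau> (Suc i) - \<tau> i) / real n)))) (\<Pi>\<^sub>M t\<in>J. borel) ?S" for f
    by (subst distr_restrict_observation[OF J\<tau> \<tau>])
      (use distr_increments[OF n m, of \<tau> "\<lambda>t. LINT x:{0..t}|lborel. f x"] \<tau> in simp_all)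
  have mS: "?S \<in> measurable (\<Pi>\<^sub>M i\<in>{..<m}. density lborel (normal_density 0 (sqrt ((\<tau> (Suc i) - \<tau> i) / real n))))
      (\<Pi>\<^sub>M t\<in>J. borel)"
    by (intro measurable_restrict borel_measurable_sum) (auto intro!: measurable_component_singleton[THEN measurable_compose])
  have "second_moment_bounded (ennreal (exp (real n * ?I))) (?D (\<lambda>_. 0)) (?D g)"
    using second_moment_bounded_distr[OF increments_second_moment_bounded[OF n g \<tau>] mS]
    unfolding law by simp
  from second_moment_bounded_emeasure[OF this, of X] X
  have *: "(emeasure (?D g) X)\<^sup>2 \<le> ennreal (exp (real n * ?I)) * emeasure (?D (\<lambda>_. 0)) X" by simp
  have cyl: "measure (distr P (\<Pi>\<^sub>M t\<in>{0..1}. borel) (observation B n f)) (prod_emb {0..1} (\<lambda>_. borel) J X)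
      = measure (?D f) X" for f
  proof -
    have "measure (distr P (\<Pi>\<^sub>M t\<in>{0..1}. borel) (observation B n f)) (prod_emb {0..1} (\<lambda>_. borel) J X)
      = measure (distr (distr P (\<Pi>\<^sub>M t\<in>{0..1}. borel) (observation B n f)) (\<Pi>\<^sub>M t\<in>J. borel) (\<lambda>z. restrict z J)) X"
      using J X by (subst measure_distr) (auto intro!: measurable_restrict_subset simp: prod_emb_def space_PiM)
    also have "distr (distr P (\<Pi>\<^sub>M t\<in>{0..1}. borel) (observation B n f)) (\<Pi>\<^sub>M t\<in>J. borel) (\<lambda>z. restrict z J) = ?D f"
      using J by (subst distr_distr) (auto intro!: measurable_restrict_subset observation_measurable simp: comp_def)
    finally show ?thesis .
  qed
  have fin: "emeasure (?D f) X = ennreal (measure (?D f) X)" for f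
    using prob_space_distr[OF measurable_compose[OF observation_measurable measurable_restrict_subset[OF J(2)]]]
    by (intro finite_measure.emeasure_eq_measure prob_space.finite_measure) auto
  show "(measure (distr P (\<Pi>\<^sub>M t\<in>{0..1}. borel) (observation B n g)) (prod_emb {0..1} (\<lambda>_. borel) J X))\<^sup>2
      \<le> exp (real n * ?I) * measure (distr P (\<Pi>\<^sub>M t\<in>{0..1}. borel) (observation B n (\<lambda>_. 0))) (prod_emb {0..1} (\<lambda>_. borel) J X)"
    using * unfolding cyl fin by (simp add: ennreal_power ennreal_mult[symmetric])
qed simp_all

end

section \<open>Lower bound from two signals\<close>

text \<open>With this measure the integrated and the pointwise risk are both the mean of a squared error over a
probability measure, so one testing argument covers both.\<close>

definition local_measure :: "real \<Rightarrow> real \<Rightarrow> real measure" where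
  "local_measure x0 c = (if c > 0 then uniform_measure lborel {x0 - c..x0 + c} else return borel x0)"

text \<open>An estimator is measurable only for arguments in $[0,1]$. Composing with the retraction onto
this interval makes it measurable on the line without changing the risk.\<close>

definition clip :: "real \<Rightarrow> real" where
  "clip x = max 0 (min 1 x)"

lemma clip_measurable [measurable]: "clip \<in> measurable borel (restrict_space borel {0..1})"
  unfolding clip_def[abs_def] by (intro measurable_restrict_space2) auto

lemma clip_id: "x \<in> {0..1} \<Longrightarrow> clip x = x"
  by (auto simp: clip_def)

lemma sets_local_measure [measurable_cong, simp]: "sets (local_measure x0 c) = sets borel"
  by (simp add: local_measure_def)

lemma prob_space_local_measure: "prob_space (local_measure x0 c)"
  unfolding local_measure_def
  by (auto intro!: prob_space_uniform_measure prob_space_return)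

lemma estimator_clip_measurable:
  assumes "estimator \<delta>"
  shows "(\<lambda>(z, x). \<delta> z (clip x)) \<in> borel_measurable ((\<Pi>\<^sub>M t\<in>{0..1}. borel) \<Otimes>\<^sub>M borel)"
proof -
  have "(\<lambda>(z, x). (z, clip x)) \<in> measurable ((\<Pi>\<^sub>M t\<in>{0..1::real}. (borel :: real measure)) \<Otimes>\<^sub>M borel)
      ((\<Pi>\<^sub>M t\<in>{0..1}. borel) \<Otimes>\<^sub>M restrict_space borel {0..1})"
    by measurable
  from measurable_compose[OF this assms[unfolded estimator_def]] show ?thesis
    by (simp add: case_prod_unfold)
qed

context standard_brownian_motion
begin

lemma risk_eq_local_measure:
  assumes \<delta>: "estimator \<delta>" and f [measurable]: "f \<in> borel_measurable borel"
    and c: "c \<ge> 0" "{x0 - c..x0 + c} \<subseteq> {0..1}"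
  shows "risk P B n \<delta> f x0 c =
    (\<integral>\<^sup>+\<omega>. (\<integral>\<^sup>+x. ennreal ((\<delta> (observation B n f \<omega>) (clip x) - f x)\<^sup>2) \<partial>local_measure x0 c) \<partial>P)"
proof -
  let ?M = "\<Pi>\<^sub>M t\<in>{0..1::real}. (borel :: real measure)"
  let ?S = "{x0 - c..x0 + c}"
  note [measurable] = estimator_clip_measurable[OF \<delta>] observation_measurable
  have m: "(\<lambda>(z, x). ennreal ((\<delta> z (clip x) - f x)\<^sup>2)) \<in> borel_measurable (?M \<Otimes>\<^sub>M borel)"
    by measurable
  have mx: "(\<lambda>x. ennreal ((\<delta> z (clip x) - f x)\<^sup>2)) \<in> borel_measurable borel" if "z \<in> space ?M" for z
    using measurable_compose[OF measurable_Pair1'[OF that] m] by simp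
  have sp: "observation B n f \<omega> \<in> space ?M" if "\<omega> \<in> space P" for \<omega>
    using measurable_space[OF observation_measurable that] .
  show ?thesis
  proof (cases "c > 0")
    case True
    have eq: "ennreal ((\<delta> z (clip x) - f x)\<^sup>2) * indicator ?S x = ennreal ((\<delta> z x - f x)\<^sup>2) * indicator ?S x" for z x
      using c(2) clip_id[of x] by (auto simp: indicator_def)
    have "(\<lambda>(z, x). ennreal ((\<delta> z (clip x) - f x)\<^sup>2) * indicator ?S x) \<in> borel_measurable (?M \<Otimes>\<^sub>M lborel)"
      using m by measurable
    then have "(\<lambda>z. \<integral>\<^sup>+x. ennreal ((\<delta> z (clip x) - f x)\<^sup>2) * indicator ?S x \<partial>lborel) \<in> borel_measurable ?M"
      by (intro lborel.borel_measurable_nn_integral)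
    from measurable_compose[OF observation_measurable this]
    have mi: "(\<lambda>\<omega>. \<integral>\<^sup>+x. ennreal ((\<delta> (observation B n f \<omega>) x - f x)\<^sup>2) * indicator ?S x \<partial>lborel) \<in> borel_measurable P"
      unfolding eq .
    have "(\<integral>\<^sup>+\<omega>. (\<integral>\<^sup>+x. ennreal ((\<delta> (observation B n f \<omega>) (clip x) - f x)\<^sup>2) \<partial>local_measure x0 c) \<partial>P)
      = (\<integral>\<^sup>+\<omega>. ennreal (1 / (2 * c)) *
          (\<integral>\<^sup>+x. ennreal ((\<delta> (observation B n f \<omega>) x - f x)\<^sup>2) * indicator ?S x \<partial>lborel) \<partial>P)"
    proof (intro nn_integral_cong)
      fix \<omega> assume "\<omega> \<in> space P"
      let ?z = "observation B n f \<omega>"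
      have "(\<integral>\<^sup>+x. ennreal ((\<delta> ?z (clip x) - f x)\<^sup>2) \<partial>local_measure x0 c) =
          (\<integral>\<^sup>+x. ennreal ((\<delta> ?z (clip x) - f x)\<^sup>2) * indicator ?S x \<partial>lborel) / emeasure lborel ?S"
        using True mx[OF sp[OF \<open>\<omega> \<in> space P\<close>]] unfolding local_measure_def
        by (simp add: nn_integral_uniform_measure)
      also have "emeasure lborel ?S = ennreal (2 * c)" using True by simp
      finally show "(\<integral>\<^sup>+x. ennreal ((\<delta> ?z (clip x) - f x)\<^sup>2) \<partial>local_measure x0 c) =
          ennreal (1 / (2 * c)) * (\<integral>\<^sup>+x. ennreal ((\<delta> ?z x - f x)\<^sup>2) * indicator ?S x \<partial>lborel)"
        using True unfolding eq by (simp add: divide_ennreal_def inverse_ennreal mult.commute inverse_eq_divide)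
    qed
    also have "\<dots> = risk P B n \<delta> f x0 c"
      using True mi by (simp add: risk_def nn_integral_cmult)
    finally show ?thesis ..
  next
    case False
    then have "c = 0" "x0 \<in> {0..1}" using c by auto
    then have "risk P B n \<delta> f x0 c = (\<integral>\<^sup>+\<omega>. ennreal ((\<delta> (observation B n f \<omega>) (clip x0) - f x0)\<^sup>2) \<partial>P)"
      by (simp add: risk_def clip_id)
    also have "\<dots> = (\<integral>\<^sup>+\<omega>. (\<integral>\<^sup>+x. ennreal ((\<delta> (observation B n f \<omega>) (clip x) - f x)\<^sup>2) \<partial>local_measure x0 c) \<partial>P)"
      using \<open>c = 0\<close> mx sp by (intro nn_integral_cong) (simp add: local_measure_def nn_integral_return)
    finally show ?thesis .
  qed
qed

text \<open>If the second moment of the likelihood ratio times the risk at zero is small compared with the size of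
$g$, then with probability at least one half the estimate is too small to be close to $g$, even when the
signal is $g$.\<close>

theorem two_point_bound:
  fixes d :: "(real \<Rightarrow> real) \<Rightarrow> real \<Rightarrow> real" and g :: "real \<Rightarrow> real"
  assumes n: "n > 0" and \<mu>: "prob_space \<mu>" "sets \<mu> = sets borel"
    and d: "(\<lambda>(z, x). d z x) \<in> borel_measurable ((\<Pi>\<^sub>M t\<in>{0..1}. borel) \<Otimes>\<^sub>M borel)"
    and g: "continuous_on UNIV g"
    and \<tau>: "\<tau> > 0" "ennreal \<tau> \<le> (\<integral>\<^sup>+x. ennreal ((g x)\<^sup>2) \<partial>\<mu>)"
    and \<rho>: "\<rho> \<ge> 0" "(\<integral>\<^sup>+\<omega>. (\<integral>\<^sup>+x. ennreal ((d (observation B n (\<lambda>_. 0) \<omega>) x)\<^sup>2) \<partial>\<mu>) \<partial>P) \<le> ennreal \<rho>"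
    and K: "16 * exp (real n * (LINT x:{0..1}|lborel. (g x)\<^sup>2)) * \<rho> \<le> \<tau>"
  shows "ennreal (\<tau> / 8) \<le> (\<integral>\<^sup>+\<omega>. (\<integral>\<^sup>+x. ennreal ((d (observation B n g \<omega>) x - g x)\<^sup>2) \<partial>\<mu>) \<partial>P)"
proof -
  let ?M = "\<Pi>\<^sub>M t\<in>{0..1::real}. (borel :: real measure)"
  let ?K = "exp (real n * (LINT x:{0..1}|lborel. (g x)\<^sup>2))"
  let ?Q = "\<lambda>f. distr P ?M (observation B n f)"
  interpret \<mu>: prob_space \<mu> by fact
  note [measurable] = d
  note [measurable_cong] = \<mu>(2)
  have gm [measurable]: "g \<in> borel_measurable borel" using g by (rule borel_measurable_continuous_onI)
  define N where "N = (\<lambda>z. \<integral>\<^sup>+x. ennreal ((d z x)\<^sup>2) \<partial>\<mu>)"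
  have Nm [measurable]: "N \<in> borel_measurable ?M"
    unfolding N_def by (intro \<mu>.borel_measurable_nn_integral) measurable
  \<comment> \<open>The event that the estimate has mean square at least $\tau/4$. On its complement $g^2 \le 2(d-g)^2 + 2d^2$ gives an error of at least $\tau/4$.\<close>
  define A where "A = {z \<in> space ?M. ennreal (\<tau> / 4) \<le> N z}"
  have Am: "A \<in> sets ?M" unfolding A_def by measurable
  interpret Q0: prob_space "?Q (\<lambda>_. 0)" by (rule prob_space_observation)
  interpret Qg: prob_space "?Q g" by (rule prob_space_observation)
  have A_eq: "A = {z \<in> space (?Q (\<lambda>_. 0)). 1 \<le> ennreal (4 / \<tau>) * N z}"
  proof -
    have "ennreal (\<tau> / 4) \<le> y \<longleftrightarrow> 1 \<le> ennreal (4 / \<tau>) * y" for y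
      using \<tau>(1) by (cases y) (auto simp: ennreal_mult[symmetric] ennreal_mult_top field_simps ennreal_le_iff simp flip: ennreal_1)
    then show ?thesis by (simp add: A_def)
  qed
  have "emeasure (?Q (\<lambda>_. 0)) A \<le> ennreal (4 / \<tau>) * (\<integral>\<^sup>+z. N z * indicator (space ?M) z \<partial>?Q (\<lambda>_. 0))"
    unfolding A_eq by (rule order_trans[OF nn_integral_Markov_inequality]) auto
  also have "(\<integral>\<^sup>+z. N z * indicator (space ?M) z \<partial>?Q (\<lambda>_. 0)) = (\<integral>\<^sup>+z. N z \<partial>?Q (\<lambda>_. 0))"
    by (intro nn_integral_cong) simp
  also have "\<dots> = (\<integral>\<^sup>+\<omega>. N (observation B n (\<lambda>_. 0) \<omega>) \<partial>P)"
    by (rule nn_integral_distr[OF observation_measurable]) simp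
  also have "ennreal (4 / \<tau>) * \<dots> \<le> ennreal (4 / \<tau>) * ennreal \<rho>"
    using \<rho>(2) unfolding N_def by (intro mult_left_mono) auto
  finally have "measure (?Q (\<lambda>_. 0)) A \<le> 4 / \<tau> * \<rho>"
    using \<tau>(1) \<rho>(1) by (simp add: Q0.emeasure_eq_measure ennreal_mult[symmetric])
  then have "?K * measure (?Q (\<lambda>_. 0)) A \<le> ?K * (4 / \<tau> * \<rho>)"
    by (intro mult_left_mono) auto
  also have "\<dots> \<le> (1 / 2)\<^sup>2" using K \<tau>(1) by (simp add: field_simps power2_eq_square)
  finally have "(measure (?Q g) A)\<^sup>2 \<le> (1 / 2)\<^sup>2"
    using observation_shift_bound[OF n continuous_on_subset[OF g subset_UNIV] Am] by linarith
  then have half: "measure (?Q g) A \<le> 1 / 2" by (rule power2_le_imp_le) simp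
  define D where "D = (\<lambda>z. \<integral>\<^sup>+x. ennreal ((d z x - g x)\<^sup>2) \<partial>\<mu>)"
  have Dm [measurable]: "D \<in> borel_measurable ?M"
    unfolding D_def by (intro \<mu>.borel_measurable_nn_integral) measurable
  have far: "ennreal (\<tau> / 4) \<le> D z" if z: "z \<in> space ?M - A" for z
  proof (rule ccontr)
    assume neg: "\<not> ennreal (\<tau> / 4) \<le> D z"
    have dz [measurable]: "d z \<in> borel_measurable \<mu>"
      using measurable_compose[OF measurable_Pair1' d, of z] z \<mu>(2) measurable_cong_sets[OF \<mu>(2) refl] by auto
    have "ennreal \<tau> \<le> (\<integral>\<^sup>+x. ennreal ((g x)\<^sup>2) \<partial>\<mu>)" by fact
    also have "\<dots> \<le> (\<integral>\<^sup>+x. 2 * ennreal ((d z x - g x)\<^sup>2) + 2 * ennreal ((d z x)\<^sup>2) \<partial>\<mu>)"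
    proof (intro nn_integral_mono)
      fix x
      have "(g x)\<^sup>2 \<le> 2 * (d z x - g x)\<^sup>2 + 2 * (d z x)\<^sup>2"
        using zero_le_power2[of "2 * d z x - g x"] by (simp add: power2_eq_square algebra_simps)
      then have "ennreal ((g x)\<^sup>2) \<le> ennreal (2 * (d z x - g x)\<^sup>2 + 2 * (d z x)\<^sup>2)" by (rule ennreal_leI)
      also have "\<dots> = 2 * ennreal ((d z x - g x)\<^sup>2) + 2 * ennreal ((d z x)\<^sup>2)"
        by (simp add: ennreal_plus ennreal_mult)
      finally show "ennreal ((g x)\<^sup>2) \<le> 2 * ennreal ((d z x - g x)\<^sup>2) + 2 * ennreal ((d z x)\<^sup>2)" .
    qed
    also have "\<dots> = 2 * D z + 2 * N z"
      unfolding D_def N_def by (simp add: nn_integral_add nn_integral_cmult)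
    finally have sum: "ennreal \<tau> \<le> 2 * D z + 2 * N z" .
    have "D z < ennreal (\<tau> / 4)" "N z < ennreal (\<tau> / 4)"
      using neg z by (auto simp: A_def)
    then obtain a b where ab: "D z = ennreal a" "a \<ge> 0" "N z = ennreal b" "b \<ge> 0" "a < \<tau> / 4" "b < \<tau> / 4"
      by (cases "D z"; cases "N z") (auto simp: ennreal_less_iff)
    have "ennreal \<tau> \<le> ennreal (2 * a + 2 * b)"
      using sum ab by (simp add: ennreal_plus ennreal_mult)
    then have "\<tau> \<le> 2 * a + 2 * b" using ab by (subst (asm) ennreal_le_iff) auto
    then show False using ab by linarith
  qed
  have "ennreal (\<tau> / 8) \<le> ennreal (\<tau> / 4) * ennreal (1 - measure (?Q g) A)"
    using half \<tau>(1) by (simp add: ennreal_mult[symmetric] ennreal_le_iff field_simps)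
  also have "\<dots> = ennreal (\<tau> / 4) * emeasure (?Q g) (space (?Q g) - A)"
    using Qg.prob_compl[of A] Am by (simp add: Qg.emeasure_eq_measure)
  also have "\<dots> = (\<integral>\<^sup>+z. ennreal (\<tau> / 4) * indicator (space ?M - A) z \<partial>?Q g)"
    using Am by (subst nn_integral_cmult_indicator) auto
  also have "\<dots> \<le> (\<integral>\<^sup>+z. D z \<partial>?Q g)"
    using far by (intro nn_integral_mono) (auto simp: indicator_def)
  also have "\<dots> = (\<integral>\<^sup>+\<omega>. D (observation B n g \<omega>) \<partial>P)"
    by (rule nn_integral_distr[OF observation_measurable]) simp
  finally show ?thesis unfolding D_def .
qed

end

section \<open>Gaussian bumps in Hoelder classes\<close>

text \<open>The rate \<open>s\<close> is generalized so that, in the induction, half of the exponent can absorb the new factor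
$x$ and the other half the remaining polynomial.\<close>

lemma poly_times_gauss_bounded:
  fixes p :: "real poly"
  shows "s > 0 \<Longrightarrow> \<exists>C. \<forall>x. \<bar>poly p x * exp (- s * x\<^sup>2)\<bar> \<le> C"
proof (induction p arbitrary: s)
  case 0
  then show ?case by (auto intro: exI[of _ 0])
next
  case (pCons a p)
  have "s / 2 > 0" using pCons.prems by simp
  from pCons.IH[OF this] obtain C where C: "\<And>x. \<bar>poly p x * exp (- (s / 2) * x\<^sup>2)\<bar> \<le> C" by blast
  have C0: "C \<ge> 0" using C[of 0] by linarith
  have lin: "\<bar>x\<bar> * exp (- (s / 2) * x\<^sup>2) \<le> 1 + 2 / s" for x
  proof -
    have "\<bar>x\<bar> \<le> 1 + x\<^sup>2"
      using zero_le_power2[of "\<bar>x\<bar> - 1"] by (simp add: power2_diff)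
    also have "\<dots> \<le> (1 + 2 / s) * (1 + s / 2 * x\<^sup>2)"
      using pCons.prems by (simp add: field_simps)
    also have "\<dots> \<le> (1 + 2 / s) * exp (s / 2 * x\<^sup>2)"
      using pCons.prems exp_ge_add_one_self[of "s / 2 * x\<^sup>2"] by (intro mult_left_mono) auto
    finally have "\<bar>x\<bar> \<le> (1 + 2 / s) * exp (s / 2 * x\<^sup>2)" .
    then have "\<bar>x\<bar> * exp (- (s / 2) * x\<^sup>2) \<le> (1 + 2 / s) * exp (s / 2 * x\<^sup>2) * exp (- (s / 2) * x\<^sup>2)"
      by (intro mult_right_mono) auto
    then show ?thesis by (simp add: mult.assoc flip: exp_add)
  qed
  have "\<bar>poly (pCons a p) x * exp (- s * x\<^sup>2)\<bar> \<le> \<bar>a\<bar> + (1 + 2 / s) * C" for x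
  proof -
    have "exp (- s * x\<^sup>2) = exp (- (s / 2) * x\<^sup>2) * exp (- (s / 2) * x\<^sup>2)"
      by (simp flip: exp_add)
    then have "\<bar>poly (pCons a p) x * exp (- s * x\<^sup>2)\<bar> \<le>
        \<bar>a\<bar> * exp (- s * x\<^sup>2) + (\<bar>x\<bar> * exp (- (s / 2) * x\<^sup>2)) * \<bar>poly p x * exp (- (s / 2) * x\<^sup>2)\<bar>"
      using abs_triangle_ineq[of "a * exp (- s * x\<^sup>2)" "x * exp (- (s / 2) * x\<^sup>2) * (poly p x * exp (- (s / 2) * x\<^sup>2))"]
      by (simp add: abs_mult algebra_simps)
    also have "\<dots> \<le> \<bar>a\<bar> * 1 + (1 + 2 / s) * C"
      using pCons.prems C0 by (intro add_mono mult_mono lin C) (auto intro: mult_nonneg_nonneg)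
    finally show ?thesis by simp
  qed
  then show ?case by blast
qed

text \<open>The polynomial factors of the derivatives of $\exp(-x^2/2)$: up to sign, the Hermite polynomials.\<close>

fun gauss_deriv_poly :: "nat \<Rightarrow> real poly" where
  "gauss_deriv_poly 0 = 1"
| "gauss_deriv_poly (Suc j) = pderiv (gauss_deriv_poly j) - [:0, 1:] * gauss_deriv_poly j"

definition gauss_deriv :: "nat \<Rightarrow> real \<Rightarrow> real" where
  "gauss_deriv j x = poly (gauss_deriv_poly j) x * exp (- (1 / 2) * x\<^sup>2)"

lemma gauss_deriv_has_derivative:
  "(gauss_deriv j has_real_derivative gauss_deriv (Suc j) x) (at x)"
  unfolding gauss_deriv_def[abs_def]
  by (auto intro!: derivative_eq_intros poly_DERIV simp: algebra_simps)

lemma gauss_deriv_bounded: "\<exists>C. \<forall>x. \<bar>gauss_deriv j x\<bar> \<le> C"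
  unfolding gauss_deriv_def by (rule poly_times_gauss_bounded) simp

text \<open>Every derivative is bounded and Lipschitz. At distances below 1 the Lipschitz bound is the stronger
one, at larger distances boundedness suffices.\<close>

lemma gauss_deriv_holder:
  assumes \<beta>: "0 < \<beta>" "\<beta> \<le> 1"
  obtains H where "H > 0" "\<And>x y. \<bar>gauss_deriv j x - gauss_deriv j y\<bar> \<le> H * \<bar>x - y\<bar> powr \<beta>"
proof -
  obtain C where C: "\<And>x. \<bar>gauss_deriv j x\<bar> \<le> C" using gauss_deriv_bounded by blast
  obtain L where L: "\<And>x. \<bar>gauss_deriv (Suc j) x\<bar> \<le> L" using gauss_deriv_bounded by blast
  have nn: "C \<ge> 0" "L \<ge> 0" using C[of 0] L[of 0] by linarith+
  have lip: "\<bar>gauss_deriv j x - gauss_deriv j y\<bar> \<le> L * \<bar>x - y\<bar>" for x y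
    using field_differentiable_bound[of UNIV "gauss_deriv j" "gauss_deriv (Suc j)" L x y]
      gauss_deriv_has_derivative L by auto
  have "\<bar>gauss_deriv j x - gauss_deriv j y\<bar> \<le> (2 * C + L + 1) * \<bar>x - y\<bar> powr \<beta>" for x y
  proof (cases "\<bar>x - y\<bar> \<le> 1")
    case True
    have "L * \<bar>x - y\<bar> \<le> L * \<bar>x - y\<bar> powr \<beta>"
    proof (cases "x = y")
      case False
      then have "\<bar>x - y\<bar> powr 1 \<le> \<bar>x - y\<bar> powr \<beta>"
        using True \<beta> by (intro powr_mono') auto
      then show ?thesis using nn False by (intro mult_left_mono) auto
    qed simp
    also have "\<dots> \<le> (2 * C + L + 1) * \<bar>x - y\<bar> powr \<beta>" using nn by (intro mult_right_mono) auto
    finally show ?thesis using lip[of x y] by linarith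
  next
    case False
    have "1 \<le> \<bar>x - y\<bar> powr \<beta>" using False \<beta> by (intro ge_one_powr_ge_zero) auto
    have "\<bar>gauss_deriv j x - gauss_deriv j y\<bar> \<le> (2 * C + L + 1) * 1"
      using C[of x] C[of y] nn abs_triangle_ineq4[of "gauss_deriv j x" "gauss_deriv j y"] by simp
    also have "\<dots> \<le> (2 * C + L + 1) * \<bar>x - y\<bar> powr \<beta>"
      using \<open>1 \<le> _\<close> nn by (intro mult_left_mono) auto
    finally show ?thesis .
  qed
  with nn show thesis by (intro that[of "2 * C + L + 1"]) auto
qed

text \<open>A Gaussian profile in place of a compactly supported one: it is smooth with explicit derivatives, and
only its size near the centre and its total energy matter. The factor $h^\alpha$ is the
scaling that keeps the Hoelder constant of order \<open>\<alpha>\<close> independent of the width.\<close>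

definition bump :: "real \<Rightarrow> real \<Rightarrow> real \<Rightarrow> real \<Rightarrow> real \<Rightarrow> real" where
  "bump \<alpha> A x0 h x = A * h powr \<alpha> * exp (- (1 / 2) * ((x - x0) / h)\<^sup>2)"

lemma holder_order_bounds:
  assumes "\<alpha> > 0"
  shows "0 < \<alpha> - real (holder_order \<alpha>)" "\<alpha> - real (holder_order \<alpha>) \<le> 1"
  using assms unfolding holder_order_def by linarith+

text \<open>The $j$-th derivative scales like $h^{\alpha-j}$. At the top order $k$ this power cancels the factor
$h^{-(\alpha-k)}$ produced by the Hoelder condition, so one amplitude serves all widths and centres.\<close>

lemma bump_in_holder_class:
  assumes "\<alpha> > 0" "M > 0"
  obtains A where "A > 0" "\<And>x0 h. h > 0 \<Longrightarrow> bump \<alpha> A x0 h \<in> holder_class \<alpha> M"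
proof -
  let ?k = "holder_order \<alpha>"
  obtain H where H: "H > 0"
    "\<And>x y. \<bar>gauss_deriv ?k x - gauss_deriv ?k y\<bar> \<le> H * \<bar>x - y\<bar> powr (\<alpha> - real ?k)"
    using gauss_deriv_holder[OF holder_order_bounds[OF assms(1)]] by blast
  define A where "A = M / H"
  have "bump \<alpha> A x0 h \<in> holder_class \<alpha> M" if h: "h > 0" for x0 h
  proof -
    define D where "D = (\<lambda>j x. A * h powr (\<alpha> - real j) * gauss_deriv j ((x - x0) / h))"
    have D0: "D 0 = bump \<alpha> A x0 h"
      by (auto simp: D_def bump_def fun_eq_iff gauss_deriv_def)
    have der: "(D j has_real_derivative D (Suc j) x) (at x within {0..1})" for j x
    proof -
      have "h powr (\<alpha> - real (Suc j)) = h powr (\<alpha> - real j) / h"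
        using h powr_diff[of h "\<alpha> - real j" 1] by (simp add: algebra_simps)
      moreover have "((\<lambda>x. A * h powr (\<alpha> - real j) * gauss_deriv j ((x - x0) / h)) has_real_derivative
          A * h powr (\<alpha> - real j) * (gauss_deriv (Suc j) ((x - x0) / h) * (1 / h))) (at x)"
        using h by (intro DERIV_cmult DERIV_chain2[OF gauss_deriv_has_derivative])
          (auto intro!: derivative_eq_intros)
      ultimately show ?thesis
        unfolding D_def by (auto intro: has_field_derivative_at_within)
    qed
    have hol: "\<bar>D ?k x - D ?k y\<bar> \<le> M * \<bar>x - y\<bar> powr (\<alpha> - real ?k)" for x y
    proof -
      have "\<bar>D ?k x - D ?k y\<bar> = A * h powr (\<alpha> - real ?k) *
          \<bar>gauss_deriv ?k ((x - x0) / h) - gauss_deriv ?k ((y - x0) / h)\<bar>"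
        using assms H(1) unfolding D_def A_def right_diff_distrib[symmetric] by (simp add: abs_mult)
      also have "\<dots> \<le> A * h powr (\<alpha> - real ?k) * (H * \<bar>(x - x0) / h - (y - x0) / h\<bar> powr (\<alpha> - real ?k))"
        using assms H(1) by (intro mult_left_mono H(2)) (auto simp: A_def)
      also have "\<bar>(x - x0) / h - (y - x0) / h\<bar> = \<bar>x - y\<bar> / h"
        using h by (simp add: abs_divide flip: diff_divide_distrib)
      also have "A * h powr (\<alpha> - real ?k) * (H * (\<bar>x - y\<bar> / h) powr (\<alpha> - real ?k)) =
          M * \<bar>x - y\<bar> powr (\<alpha> - real ?k)"
        using h H(1) by (simp add: A_def powr_divide)
      finally show ?thesis .
    qed
    show ?thesis
      unfolding holder_class_def using D0 der hol by blast
  qed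
  moreover have "A > 0" using assms H(1) by (simp add: A_def)
  ultimately show thesis using that by blast
qed

lemma bump_continuous: "continuous_on S (bump \<alpha> A x0 h)"
  unfolding bump_def[abs_def] by (cases "h = 0") (auto intro!: continuous_intros)

lemma zero_in_holder_class: "M > 0 \<Longrightarrow> (\<lambda>_. 0) \<in> holder_class \<alpha> M"
  unfolding holder_class_def by (auto intro!: exI[of _ "\<lambda>_ _. 0"])

lemma bump_square:
  assumes "h > 0"
  shows "(bump \<alpha> A x0 h x)\<^sup>2 = A\<^sup>2 * h powr (2 * \<alpha>) * exp (- ((x - x0) / h)\<^sup>2)"
proof -
  have "(h powr \<alpha>)\<^sup>2 = h powr (2 * \<alpha>)"
    using assms by (simp add: power2_eq_square flip: powr_add)
  then show ?thesis
    by (simp add: bump_def power_mult_distrib exp_double[symmetric])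
qed

text \<open>The square of the bump is a multiple of the normal density with mean \<open>x0\<close> and variance $h^2/2$.\<close>

lemma bump_energy:
  assumes h: "h > 0" and A: "A > 0"
  shows "(LINT x:{0..1}|lborel. (bump \<alpha> A x0 h x)\<^sup>2) \<le> A\<^sup>2 * sqrt pi * h powr (2 * \<alpha> + 1)"
proof -
  let ?\<sigma> = "h / sqrt 2"
  have \<sigma>: "?\<sigma> > 0" using h by simp
  have eq: "(bump \<alpha> A x0 h x)\<^sup>2 = A\<^sup>2 * sqrt pi * h powr (2 * \<alpha> + 1) * normal_density x0 ?\<sigma> x" for x
  proof -
    have "normal_density x0 ?\<sigma> x = exp (- ((x - x0) / h)\<^sup>2) / (sqrt pi * h)"
      using h by (simp add: normal_density_def power_divide real_sqrt_mult)
    then show ?thesis using h by (simp add: bump_square powr_add)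
  qed
  have int: "integrable lborel (\<lambda>x. A\<^sup>2 * sqrt pi * h powr (2 * \<alpha> + 1) * normal_density x0 ?\<sigma> x)"
    using \<sigma> by (intro integrable_mult_right) simp
  have "(LINT x:{0..1}|lborel. (bump \<alpha> A x0 h x)\<^sup>2) \<le> (LINT x|lborel. (bump \<alpha> A x0 h x)\<^sup>2)"
    unfolding set_lebesgue_integral_def eq
    using int by (intro integral_mono integrable_mult_indicator) (auto simp: indicator_def)
  also have "\<dots> = A\<^sup>2 * sqrt pi * h powr (2 * \<alpha> + 1)"
    unfolding eq using \<sigma> by simp
  finally show ?thesis .
qed

lemma bump_lower_bound:
  assumes "h > 0" "A > 0" "\<bar>x - x0\<bar> \<le> h"
  shows "A\<^sup>2 * exp (- 1) * h powr (2 * \<alpha>) \<le> (bump \<alpha> A x0 h x)\<^sup>2"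
proof -
  have "((x - x0) / h)\<^sup>2 \<le> 1"
    using assms by (simp add: abs_square_le_1 abs_divide)
  then have "exp (- 1) \<le> exp (- ((x - x0) / h)\<^sup>2)" by simp
  then show ?thesis using assms by (simp add: bump_square mult.commute mult.left_commute)
qed

section \<open>The price of superefficiency\<close>

text \<open>The true measure is $\min(1, h/c)$. The bound is stated through the product \<open>w * c\<close> so that it also
covers \<open>c = 0\<close>, where the measure is a point mass and a quotient by \<open>c\<close> would be meaningless.\<close>

lemma emeasure_local_measure_interval:
  assumes c: "c \<ge> 0" and h: "h > 0" and w: "0 \<le> w" "w \<le> 1" "w * c \<le> h"
  shows "ennreal w \<le> emeasure (local_measure x0 c) {x0 - h..x0 + h}"
proof (cases "c > 0")
  case True
  have "{x0 - c..x0 + c} \<inter> {x0 - h..x0 + h} = {x0 - min c h..x0 + min c h}" by auto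
  moreover have len: "emeasure lborel {x0 - e..x0 + e} = ennreal (2 * e)" if "e \<ge> 0" for e
    using that by simp
  ultimately have "emeasure (local_measure x0 c) {x0 - h..x0 + h} = ennreal (2 * min c h) / ennreal (2 * c)"
    using True h len[of c] len[of "min c h"] by (simp add: local_measure_def del: emeasure_lborel_Icc_eq Int_atLeastAtMost)
  also have "\<dots> = ennreal (min c h / c)" using True h by (simp add: divide_ennreal)
  also have "ennreal w \<le> \<dots>"
    using True w mult_right_mono[OF w(2), of c] by (intro ennreal_leI) (simp add: field_simps)
  finally show ?thesis .
next
  case False
  then show ?thesis using w h by (simp add: local_measure_def)
qed

lemma local_measure_bump_bound:
  assumes c: "c \<ge> 0" and h: "h > 0" and A: "A > 0" and w: "0 \<le> w" "w \<le> 1" "w * c \<le> h"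
  shows "ennreal (A\<^sup>2 * exp (- 1) * h powr (2 * \<alpha>) * w) \<le>
    (\<integral>\<^sup>+x. ennreal ((bump \<alpha> A x0 h x)\<^sup>2) \<partial>local_measure x0 c)"
proof -
  have "ennreal (A\<^sup>2 * exp (- 1) * h powr (2 * \<alpha>) * w) =
      ennreal (A\<^sup>2 * exp (- 1) * h powr (2 * \<alpha>)) * ennreal w"
    using w by (simp add: ennreal_mult)
  also have "\<dots> \<le> ennreal (A\<^sup>2 * exp (- 1) * h powr (2 * \<alpha>)) * emeasure (local_measure x0 c) {x0 - h..x0 + h}"
    by (intro mult_left_mono emeasure_local_measure_interval assms) auto
  also have "\<dots> = (\<integral>\<^sup>+x. ennreal (A\<^sup>2 * exp (- 1) * h powr (2 * \<alpha>)) * indicator {x0 - h..x0 + h} x \<partial>local_measure x0 c)"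
    by (subst nn_integral_cmult_indicator) auto
  also have "\<dots> \<le> (\<integral>\<^sup>+x. ennreal ((bump \<alpha> A x0 h x)\<^sup>2) \<partial>local_measure x0 c)"
    using bump_lower_bound[OF h A, of _ x0 \<alpha>]
    by (intro nn_integral_mono) (auto simp: indicator_def abs_le_iff intro!: ennreal_leI)
  finally show ?thesis .
qed

context standard_brownian_motion
begin

text \<open>The denominator records the two regimes. If $d_n$ is at most of order $(\log n)^{1/(1+2a)}$, the
neighbourhood is at most of the order of the bump's width, and the local mean square of the bump is of
order $h^{2a}$; otherwise the bump covers only a fraction of order $h/c_n$ of the neighbourhood. The
bound $d_n \le \log n$ keeps the whole expression above a multiple of $n^{-2a/(1+2a)}$, to which the
risk at zero is compared.\<close>

theorem superefficiency_lower_bound: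
  fixes a M r x0 C :: real and c d :: "nat \<Rightarrow> real" and \<delta> :: "nat \<Rightarrow> (real \<Rightarrow> real) \<Rightarrow> real \<Rightarrow> real"
  assumes a: "a > 0" and M: "M > 0" and r: "r > 2 * a / (1 + 2 * a)"
    and \<delta>: "\<And>n. estimator (\<delta> n)"
    and d: "\<And>n. n \<ge> 1 \<Longrightarrow> d n \<ge> 0"
    and c: "\<And>n. n \<ge> 1 \<Longrightarrow> c n = d n * real n powr (- 1 / (1 + 2 * a))"
    and nbhd: "\<And>n. n \<ge> 1 \<Longrightarrow> {x0 - c n..x0 + c n} \<subseteq> {0..1}"
    and C: "C \<ge> 0" "\<forall>\<^sub>F n in sequentially. risk P B n (\<delta> n) (\<lambda>_. 0) x0 (c n) \<le> ennreal (C * real n powr - r)"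
    and dL: "\<forall>\<^sub>F n in sequentially. d n \<le> ln (real n)"
  obtains K where "K > 0" "\<forall>\<^sub>F n in sequentially.
      ennreal (K * ((ln (real n) / real n) powr (2 * a / (1 + 2 * a)) /
        max 1 (d n / ln (real n) powr (1 / (1 + 2 * a))))) \<le>
      (SUP f\<in>holder_class a M. risk P B n (\<delta> n) f x0 (c n))"
proof -
  define \<beta> where "\<beta> = 1 / (1 + 2 * a)"
  define p where "p = 2 * a / (1 + 2 * a)"
  have \<beta>: "\<beta> > 0" "\<beta> + p = 1" "\<beta> * (2 * a + 1) = 1" "\<beta> * (2 * a) = p" "- 1 / (1 + 2 * a) = - \<beta>"
    using a by (auto simp: \<beta>_def p_def field_simps)
  obtain A where A: "A > 0" "\<And>x0 h. h > 0 \<Longrightarrow> bump a A x0 h \<in> holder_class a M"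
    using bump_in_holder_class[OF a M] by blast
  \<comment> \<open>The likelihood ratio may have second moment $n^\eta$ and still lose against
      $n^{-r}$ relative to $n^{-p}$; \<open>\<kappa>\<close> is then the width constant for which $n\|g\|^2 \le \eta \log n$.\<close>
  define \<eta> where "\<eta> = (r - p) / 2"
  have \<eta>: "\<eta> > 0" using r by (simp add: \<eta>_def p_def)
  define \<kappa> where "\<kappa> = \<eta> / (A\<^sup>2 * sqrt pi)"
  have \<kappa>: "\<kappa> > 0" using \<eta> A by (simp add: \<kappa>_def)
  define k where "k = min 1 (\<kappa> powr \<beta>)"
  have k: "0 < k" "k \<le> 1" "k \<le> \<kappa> powr \<beta>" using \<kappa> by (auto simp: k_def)
  define K where "K = A\<^sup>2 * exp (- 1) * \<kappa> powr p * k"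
  have K: "K > 0" using A \<kappa> k by (simp add: K_def)
  have "((\<lambda>n. 16 * C * real n powr - \<eta>) \<longlongrightarrow> 16 * C * 0) sequentially"
    using \<eta> by (intro tendsto_mult_left tendsto_neg_powr filterlim_real_sequentially) auto
  then have small: "\<forall>\<^sub>F n in sequentially. 16 * C * real n powr - \<eta> < K"
    using K by (intro order_tendstoD) auto
  have "\<forall>\<^sub>F n in sequentially. ennreal (K / 8 * ((ln (real n) / real n) powr p / max 1 (d n / ln (real n) powr \<beta>)))
      \<le> (SUP f\<in>holder_class a M. risk P B n (\<delta> n) f x0 (c n))"
    using small C(2) dL eventually_ge_at_top[of 3]
  proof eventually_elim
    case (elim n)
    have n: "n \<ge> 1" "n > 0" "real n > 0" using elim by auto
    define L where "L = ln (real n)"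
    have "exp 1 \<le> real n" using exp_le elim by linarith
    then have L: "L \<ge> 1" using n by (simp add: L_def ln_ge_iff)
    have L\<beta>: "L powr \<beta> > 0" using L by simp
    define h where "h = (\<kappa> * L / real n) powr \<beta>"
    have h: "h > 0" using \<kappa> L n by (simp add: h_def)
    have h_split: "h = \<kappa> powr \<beta> * L powr \<beta> * real n powr - \<beta>"
      using \<kappa> L n by (simp add: h_def powr_divide powr_mult powr_minus_divide)
    define q where "q = max 1 (d n / L powr \<beta>)"
    have q: "q \<ge> 1" "d n / L powr \<beta> \<le> q" by (auto simp: q_def)
    \<comment> \<open>A lower bound for the fraction of the neighbourhood covered by the bump: $c_n/h$ is
        $d_n/(\kappa^\beta (\log n)^\beta)$, and \<open>k\<close> takes care of $\kappa^\beta$.\<close>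
    define w where "w = k / q"
    have w: "0 \<le> w" "w \<le> 1" using k q by (auto simp: w_def field_simps)
    have dq: "d n / q \<le> L powr \<beta>" using q L\<beta> by (simp add: field_simps)
    have "w * c n = k * (d n / q) * real n powr - \<beta>"
      using c[OF n(1)] \<beta>(5) by (simp add: w_def)
    also have "\<dots> \<le> \<kappa> powr \<beta> * L powr \<beta> * real n powr - \<beta>"
      using k dq d[OF n(1)] q by (intro mult_right_mono mult_mono) auto
    finally have wc: "w * c n \<le> h" by (simp add: h_split)
    have c0: "c n \<ge> 0" using c[OF n(1)] d[OF n(1)] by simp
    define \<tau> where "\<tau> = A\<^sup>2 * exp (- 1) * h powr (2 * a) * w"
    have h2a: "h powr (2 * a) = \<kappa> powr p * (L / real n) powr p"
      using \<kappa> L n by (simp add: h_def powr_powr \<beta>(4) powr_mult powr_divide)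
    have \<tau>_eq: "\<tau> = K * ((L / real n) powr p / q)"
      by (simp add: \<tau>_def h2a K_def w_def)
    have "p = 1 - \<beta>" using \<beta>(2) by simp
    have "q \<le> L powr p"
    proof -
      have "L powr p = L / L powr \<beta>"
        using L powr_diff[of L 1 \<beta>] \<open>p = 1 - \<beta>\<close> by simp
      moreover have "d n / L powr \<beta> \<le> L / L powr \<beta>"
        using elim(3) L\<beta> by (intro divide_right_mono) (auto simp: L_def)
      moreover have "1 \<le> L powr p" using L a by (intro ge_one_powr_ge_zero) (auto simp: p_def)
      ultimately show ?thesis by (simp add: q_def)
    qed
    then have "real n powr - p \<le> (L / real n) powr p / q"
      using L n q by (simp add: powr_divide powr_minus_divide field_simps)
    then have \<tau>_ge: "K * real n powr - p \<le> \<tau>"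
      unfolding \<tau>_eq using K by (intro mult_left_mono) auto
    have \<tau>_pos: "\<tau> > 0" using \<tau>_ge K n by (smt (verit) mult_pos_pos powr_gt_zero)
    let ?g = "bump a A x0 h"
    have "real n * (LINT x:{0..1}|lborel. (?g x)\<^sup>2) \<le> real n * (A\<^sup>2 * sqrt pi * h powr (2 * a + 1))"
      by (intro mult_left_mono bump_energy h A) auto
    also have "h powr (2 * a + 1) = \<kappa> * L / real n"
      using \<kappa> L n by (simp add: h_def powr_powr \<beta>(3))
    also have "real n * (A\<^sup>2 * sqrt pi * (\<kappa> * L / real n)) = \<eta> * L"
      using n A by (simp add: \<kappa>_def)
    finally have "exp (real n * (LINT x:{0..1}|lborel. (?g x)\<^sup>2)) \<le> real n powr \<eta>"
      using n by (simp add: powr_def L_def)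
    then have "16 * exp (real n * (LINT x:{0..1}|lborel. (?g x)\<^sup>2)) * (C * real n powr - r)
        \<le> 16 * real n powr \<eta> * (C * real n powr - r)"
      using C(1) by (intro mult_right_mono mult_left_mono) auto
    also have "\<dots> = 16 * C * (real n powr \<eta> * real n powr - r)" by simp
    also have "\<dots> = 16 * C * real n powr - \<eta> * real n powr - p"
      by (simp add: powr_add[symmetric] \<eta>_def field_simps)
    also have "\<dots> \<le> K * real n powr - p"
      using elim(1) by (intro mult_right_mono) auto
    also note \<tau>_ge
    finally have cond: "16 * exp (real n * (LINT x:{0..1}|lborel. (?g x)\<^sup>2)) * (C * real n powr - r) \<le> \<tau>" .
    have gm: "?g \<in> borel_measurable borel"
      by (intro borel_measurable_continuous_onI bump_continuous)
    have "ennreal (\<tau> / 8) \<le> (\<integral>\<^sup>+\<omega>. (\<integral>\<^sup>+x. ennreal ((\<delta> n (observation B n ?g \<omega>) (clip x) - ?g x)\<^sup>2)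
        \<partial>local_measure x0 (c n)) \<partial>P)"
    proof (rule two_point_bound[OF n(2) prob_space_local_measure sets_local_measure
          estimator_clip_measurable[OF \<delta>] bump_continuous \<tau>_pos _ _ _ cond])
      show "ennreal \<tau> \<le> (\<integral>\<^sup>+x. ennreal ((?g x)\<^sup>2) \<partial>local_measure x0 (c n))"
        unfolding \<tau>_def by (rule local_measure_bump_bound[OF c0 h A(1) w wc])
      show "(\<integral>\<^sup>+\<omega>. (\<integral>\<^sup>+x. ennreal ((\<delta> n (observation B n (\<lambda>_. 0) \<omega>) (clip x))\<^sup>2)
        \<partial>local_measure x0 (c n)) \<partial>P) \<le> ennreal (C * real n powr - r)"
        using elim(2) risk_eq_local_measure[OF \<delta> _ c0 nbhd[OF n(1)], of "\<lambda>_. 0"] by simp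
    qed (use C(1) in auto)
    also have "\<dots> = risk P B n (\<delta> n) ?g x0 (c n)"
      by (rule risk_eq_local_measure[OF \<delta> gm c0 nbhd[OF n(1)], symmetric])
    also have "\<dots> \<le> (SUP f\<in>holder_class a M. risk P B n (\<delta> n) f x0 (c n))"
      by (intro SUP_upper A(2) h)
    finally show ?case by (simp add: \<tau>_eq q_def L_def mult.commute)
  qed
  then show thesis
    using K by (intro that[of "K / 8"]) (auto simp: \<beta>_def p_def)
qed

end

lemma eventually_ln_ge: "\<forall>\<^sub>F n in sequentially. Z \<le> ln (real n)"
  using filterlim_compose[OF ln_at_top filterlim_real_sequentially]
  by (simp add: filterlim_at_top)

lemma limsup_finite_imp_bound:
  assumes "limsup (\<lambda>n. ennreal (real n powr r) * R n) < \<infinity>"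
  obtains C where "C \<ge> 0" "\<forall>\<^sub>F n in sequentially. R n \<le> ennreal (C * real n powr - r)"
proof -
  obtain y where y: "limsup (\<lambda>n. ennreal (real n powr r) * R n) < y" "y < \<infinity>"
    using dense[OF assms] by blast
  obtain C where C: "y = ennreal C" "C \<ge> 0" using y(2) by (cases y) auto
  have "\<forall>\<^sub>F n in sequentially. R n \<le> ennreal (C * real n powr - r)"
    using Limsup_lessD[OF y(1)] eventually_gt_at_top[of 0]
  proof eventually_elim
    case (elim n)
    have "R n = ennreal (real n powr - r) * (ennreal (real n powr r) * R n)"
      using elim(2) by (simp add: mult.assoc[symmetric] ennreal_mult[symmetric] powr_add[symmetric])
    also have "\<dots> \<le> ennreal (real n powr - r) * ennreal C"
      using elim(1) by (intro mult_left_mono) (auto simp: C)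
    finally show ?case using C by (simp add: ennreal_mult mult.commute)
  qed
  with C(2) show thesis by (rule that)
qed

section \<open>Rates for integrated and pointwise risk\<close>

theorem corollary2:
  fixes P :: "'a measure" and B :: "real \<Rightarrow> 'a \<Rightarrow> real"
    and \<alpha>1 \<alpha>2 M1 M2 x0 :: real and c d :: "nat \<Rightarrow> real"
  assumes BM: "standard_brownian_motion P B"
    and \<alpha>: "0 < \<alpha>1" "\<alpha>1 < \<alpha>2"
    and M: "0 < M1" "0 < M2"
    and x0: "0 < x0" "x0 < 1"
    and d: "\<And>n. n \<ge> 1 \<Longrightarrow> d n \<ge> 0"
    and c: "\<And>n. n \<ge> 1 \<Longrightarrow> c n = d n * real n powr (- 1 / (1 + 2 * \<alpha>1))"
    and nbhd: "\<And>n. n \<ge> 1 \<Longrightarrow> {x0 - c n..x0 + c n} \<subseteq> {0..1}"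
  shows
    "(limsup (\<lambda>n. ereal (d n * ln (real n) powr (- 1))) = 0 \<longrightarrow>
       (INF \<delta>\<in>{\<delta>. \<forall>n. estimator (\<delta> n)}.
          max
            (limsup (\<lambda>n. ennreal (real n powr (2 * \<alpha>1 / (1 + 2 * \<alpha>1))) *
               (SUP f\<in>holder_class \<alpha>1 M1. risk P B n (\<delta> n) f x0 (c n))))
            (limsup (\<lambda>n. ennreal (real n powr (2 * \<alpha>2 / (1 + 2 * \<alpha>2))) *
               (SUP f\<in>holder_class \<alpha>2 M2. risk P B n (\<delta> n) f x0 (c n))))) = \<infinity>)
     \<and>
     (\<forall>\<delta> r.
       (\<forall>n. estimator (\<delta> n)) \<and> r > 2 * \<alpha>1 / (1 + 2 * \<alpha>1) \<and>
       limsup (\<lambda>n. ennreal (real n powr r) *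
         (SUP f\<in>holder_class \<alpha>2 M2. risk P B n (\<delta> n) f x0 (c n))) < \<infinity>
       \<longrightarrow>
       (limsup (\<lambda>n. ereal (d n * ln (real n) powr (- 1 / (1 + 2 * \<alpha>1)))) = 0 \<longrightarrow>
          liminf (\<lambda>n. ennreal ((real n / ln (real n)) powr (2 * \<alpha>1 / (1 + 2 * \<alpha>1))) *
            (SUP f\<in>holder_class \<alpha>1 M1. risk P B n (\<delta> n) f x0 (c n))) > 0)
       \<and>
       (liminf (\<lambda>n. ereal (d n * ln (real n) powr (- 1 / (1 + 2 * \<alpha>1)))) > 0 \<and>
        limsup (\<lambda>n. ereal (d n * ln (real n) powr (- 1))) = 0 \<longrightarrow>
          liminf (\<lambda>n. ennreal (real n powr (2 * \<alpha>1 / (1 + 2 * \<alpha>1)) * (d n / ln (real n))) *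
            (SUP f\<in>holder_class \<alpha>1 M1. risk P B n (\<delta> n) f x0 (c n))) > 0))"
proof -
  interpret standard_brownian_motion P B by (rule BM)
  define \<beta> where "\<beta> = 1 / (1 + 2 * \<alpha>1)"
  define p where "p = 2 * \<alpha>1 / (1 + 2 * \<alpha>1)"
  define S1 where "S1 = (\<lambda>\<delta> n. SUP f\<in>holder_class \<alpha>1 M1. risk P B n (\<delta> n) f x0 (c n))"
  define S2 where "S2 = (\<lambda>\<delta> n. SUP f\<in>holder_class \<alpha>2 M2. risk P B n (\<delta> n) f x0 (c n))"
  have \<beta>: "\<beta> > 0" "p > 0" "\<beta> = 1 - p" "- 1 / (1 + 2 * \<alpha>1) = - \<beta>"
    using \<alpha> by (auto simp: \<beta>_def p_def field_simps)
  have rate: "2 * \<alpha>1 / (1 + 2 * \<alpha>1) < 2 * \<alpha>2 / (1 + 2 * \<alpha>2)"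
    using \<alpha> by (simp add: field_simps)
  have lower: "\<exists>K>0. \<forall>\<^sub>F n in sequentially.
      ennreal (K * ((ln (real n) / real n) powr p / max 1 (d n / ln (real n) powr \<beta>))) \<le> S1 \<delta> n"
    if \<delta>: "\<forall>n. estimator (\<delta> n)" and r: "r > p"
      and fin: "limsup (\<lambda>n. ennreal (real n powr r) * S2 \<delta> n) < \<infinity>"
      and dL: "\<forall>\<^sub>F n in sequentially. d n \<le> ln (real n)" for \<delta> r
  proof -
    obtain C where C: "C \<ge> 0" "\<forall>\<^sub>F n in sequentially. S2 \<delta> n \<le> ennreal (C * real n powr - r)"
      using limsup_finite_imp_bound[OF fin] by blast
    have "risk P B n (\<delta> n) (\<lambda>_. 0) x0 (c n) \<le> S2 \<delta> n" for n
      unfolding S2_def using zero_in_holder_class[OF M(2)] by (rule SUP_upper)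
    with C(2) have "\<forall>\<^sub>F n in sequentially. risk P B n (\<delta> n) (\<lambda>_. 0) x0 (c n) \<le> ennreal (C * real n powr - r)"
      by (auto elim!: eventually_mono intro: order_trans)
    from superefficiency_lower_bound[OF \<alpha>(1) M(1) r[unfolded p_def] spec[OF \<delta>] d c nbhd C(1) this dL]
    show ?thesis unfolding S1_def p_def \<beta>_def by blast
  qed
  have small: "\<forall>\<^sub>F n in sequentially. d n \<le> e * ln (real n)"
    if "limsup (\<lambda>n. ereal (d n * ln (real n) powr (- 1))) = 0" "e > 0" for e
  proof -
    have "limsup (\<lambda>n. ereal (d n * ln (real n) powr (- 1))) < ereal e" using that by simp
    from Limsup_lessD[OF this] eventually_ln_ge[of 1] show ?thesis
      by eventually_elim (simp add: powr_minus_divide field_simps)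
  qed
  have part1: "max (limsup (\<lambda>n. ennreal (real n powr p) * S1 \<delta> n))
      (limsup (\<lambda>n. ennreal (real n powr (2 * \<alpha>2 / (1 + 2 * \<alpha>2))) * S2 \<delta> n)) = \<infinity>"
    if lim: "limsup (\<lambda>n. ereal (d n * ln (real n) powr (- 1))) = 0" and \<delta>: "\<forall>n. estimator (\<delta> n)" for \<delta>
  proof (cases "limsup (\<lambda>n. ennreal (real n powr (2 * \<alpha>2 / (1 + 2 * \<alpha>2))) * S2 \<delta> n) < \<infinity>")
    case True
    have "\<forall>\<^sub>F n in sequentially. d n \<le> ln (real n)" using small[OF lim, of 1] by simp
    from lower[OF \<delta> _ True this] rate obtain K where K: "K > 0" "\<forall>\<^sub>F n in sequentially.
      ennreal (K * ((ln (real n) / real n) powr p / max 1 (d n / ln (real n) powr \<beta>))) \<le> S1 \<delta> n"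
      unfolding p_def by blast
    \<comment> \<open>With $L = \log n$ the normalized lower bound is $K L^p / \max(1, d_n/L^\beta)$, which is the
        minimum of $L^p$ and $L/d_n$ up to the factor $K$; both tend to infinity.\<close>
    have ge: "ennreal (K * Z) \<le> liminf (\<lambda>n. ennreal (real n powr p) * S1 \<delta> n)" if Z: "Z > 0" for Z
    proof (rule Liminf_bounded)
      have dZ: "\<forall>\<^sub>F n in sequentially. d n \<le> 1 / Z * ln (real n)" by (rule small[OF lim]) (use Z in simp)
      show "\<forall>\<^sub>F n in sequentially. ennreal (K * Z) \<le> ennreal (real n powr p) * S1 \<delta> n"
        using K(2) dZ eventually_ln_ge[of 1] eventually_ln_ge[of "Z powr (1 / p)"]
          eventually_gt_at_top[of 0]
      proof (eventually_elim)
        case (elim n)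
        define L where "L = ln (real n)"
        have L: "L \<ge> 1" "L \<ge> Z powr (1 / p)" "d n \<le> L / Z" using elim Z by (auto simp: L_def)
        have "(Z powr (1 / p)) powr p \<le> L powr p" using L \<beta> by (intro powr_mono2) auto
        then have ZL: "Z \<le> L powr p" using Z \<beta> by (simp add: powr_powr)
        have L\<beta>: "L powr \<beta> * L powr p = L" using L \<beta>(3) by (simp flip: powr_add)
        have "Z * (d n / L powr \<beta>) \<le> L / L powr \<beta>"
          using L Z by (simp add: field_simps divide_right_mono)
        also have "\<dots> = L powr p" using L\<beta> L by (simp add: field_simps)
        finally have "Z * max 1 (d n / L powr \<beta>) \<le> L powr p"
          using ZL by (auto simp: max_def)
        then have ZL': "Z \<le> L powr p / max 1 (d n / L powr \<beta>)"
          by (subst pos_le_divide_eq) auto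
        have "K * Z \<le> real n powr p * (K * ((L / real n) powr p / max 1 (d n / L powr \<beta>)))"
          using mult_left_mono[OF ZL', of K] K(1) L elim(5) by (simp add: powr_divide)
        then have "ennreal (K * Z) \<le> ennreal (real n powr p) * ennreal (K * ((L / real n) powr p / max 1 (d n / L powr \<beta>)))"
          by (subst ennreal_mult'[symmetric]) (auto intro: ennreal_leI)
        also have "\<dots> \<le> ennreal (real n powr p) * S1 \<delta> n"
          using elim(1) by (intro mult_left_mono) (auto simp: L_def)
        finally show ?case .
      qed
    qed
    have "liminf (\<lambda>n. ennreal (real n powr p) * S1 \<delta> n) = \<infinity>"
    proof (rule ccontr)
      assume "liminf (\<lambda>n. ennreal (real n powr p) * S1 \<delta> n) \<noteq> \<infinity>"
      then obtain y where y: "liminf (\<lambda>n. ennreal (real n powr p) * S1 \<delta> n) = ennreal y" "y \<ge> 0"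
        by (cases "liminf (\<lambda>n. ennreal (real n powr p) * S1 \<delta> n)") auto
      have "ennreal (K * ((y + 1) / K)) \<le> ennreal y" using ge[of "(y + 1) / K"] K(1) y by simp
      then have "ennreal (y + 1) \<le> ennreal y" using K(1) by simp
      then show False using y(2) by (subst (asm) ennreal_le_iff) auto
    qed
    then have "limsup (\<lambda>n. ennreal (real n powr p) * S1 \<delta> n) = \<infinity>"
      using Liminf_le_Limsup[of sequentially "\<lambda>n. ennreal (real n powr p) * S1 \<delta> n"]
      by (simp add: top_unique)
    then show ?thesis by (simp add: max_def top_unique)
  next
    case False
    then show ?thesis by (simp add: max_def less_top[symmetric])
  qed
  have part2: "liminf (\<lambda>n. ennreal ((real n / ln (real n)) powr p) * S1 \<delta> n) > 0"
    if \<delta>: "\<forall>n. estimator (\<delta> n)" and r: "r > p"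
      and fin: "limsup (\<lambda>n. ennreal (real n powr r) * S2 \<delta> n) < \<infinity>"
      and lim: "limsup (\<lambda>n. ereal (d n * ln (real n) powr - \<beta>)) = 0" for \<delta> r
  proof -
    have "limsup (\<lambda>n. ereal (d n * ln (real n) powr - \<beta>)) < ereal 1" using lim by simp
    from Limsup_lessD[OF this] eventually_ln_ge[of 1]
    have d\<beta>: "\<forall>\<^sub>F n in sequentially. d n / ln (real n) powr \<beta> \<le> 1"
      by eventually_elim (simp add: powr_minus_divide)
    have dL: "\<forall>\<^sub>F n in sequentially. d n \<le> ln (real n)"
      using d\<beta> eventually_ln_ge[of 1]
    proof eventually_elim
      case (elim n)
      have "d n \<le> ln (real n) powr \<beta>" using elim by (simp add: field_simps)
      also have "\<dots> \<le> ln (real n) powr 1" using elim \<beta> by (intro powr_mono) auto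
      finally show ?case using elim by simp
    qed
    from lower[OF \<delta> r fin dL] obtain K where K: "K > 0" "\<forall>\<^sub>F n in sequentially.
      ennreal (K * ((ln (real n) / real n) powr p / max 1 (d n / ln (real n) powr \<beta>))) \<le> S1 \<delta> n" by blast
    have "ennreal K \<le> liminf (\<lambda>n. ennreal ((real n / ln (real n)) powr p) * S1 \<delta> n)"
    proof (rule Liminf_bounded)
      show "\<forall>\<^sub>F n in sequentially. ennreal K \<le> ennreal ((real n / ln (real n)) powr p) * S1 \<delta> n"
        using K(2) d\<beta> eventually_ln_ge[of 1] eventually_gt_at_top[of 0]
      proof eventually_elim
        case (elim n)
        have "n \<noteq> 1" using elim(3) by auto
        have "ennreal K = ennreal ((real n / ln (real n)) powr p) * ennreal (K * (ln (real n) / real n) powr p)"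
          using elim \<open>n \<noteq> 1\<close> K(1) by (simp add: ennreal_mult'[symmetric] powr_divide)
        also have "\<dots> \<le> ennreal ((real n / ln (real n)) powr p) * S1 \<delta> n"
          using elim(1,2) by (intro mult_left_mono) (auto simp: max_def split: if_splits)
        finally show ?case .
      qed
    qed
    then show ?thesis using K(1) by (meson ennreal_less_zero_iff less_le_trans)
  qed
  have part3: "liminf (\<lambda>n. ennreal (real n powr p * (d n / ln (real n))) * S1 \<delta> n) > 0"
    if \<delta>: "\<forall>n. estimator (\<delta> n)" and r: "r > p"
      and fin: "limsup (\<lambda>n. ennreal (real n powr r) * S2 \<delta> n) < \<infinity>"
      and low: "liminf (\<lambda>n. ereal (d n * ln (real n) powr - \<beta>)) > 0"
      and lim: "limsup (\<lambda>n. ereal (d n * ln (real n) powr (- 1))) = 0" for \<delta> r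
  proof -
    obtain b where b: "b > 0" "ereal b < liminf (\<lambda>n. ereal (d n * ln (real n) powr - \<beta>))"
      using ereal_dense2[OF low] by auto
    from less_LiminfD[OF b(2)] eventually_ln_ge[of 1]
    have d\<beta>: "\<forall>\<^sub>F n in sequentially. b \<le> d n / ln (real n) powr \<beta>"
      by eventually_elim (simp add: powr_minus_divide)
    have "\<forall>\<^sub>F n in sequentially. d n \<le> ln (real n)" using small[OF lim, of 1] by simp
    from lower[OF \<delta> r fin this] obtain K where K: "K > 0" "\<forall>\<^sub>F n in sequentially.
      ennreal (K * ((ln (real n) / real n) powr p / max 1 (d n / ln (real n) powr \<beta>))) \<le> S1 \<delta> n" by blast
    have "ennreal (K * min 1 b) \<le> liminf (\<lambda>n. ennreal (real n powr p * (d n / ln (real n))) * S1 \<delta> n)"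
    proof (rule Liminf_bounded)
      show "\<forall>\<^sub>F n in sequentially. ennreal (K * min 1 b) \<le> ennreal (real n powr p * (d n / ln (real n))) * S1 \<delta> n"
        using K(2) d\<beta> eventually_ln_ge[of 1] eventually_gt_at_top[of 0]
      proof eventually_elim
        case (elim n)
        define L where "L = ln (real n)"
        \<comment> \<open>Since $\beta + p = 1$, the normalized bound depends on $n$ only through \<open>s / max 1 s\<close>.\<close>
        define s where "s = d n / L powr \<beta>"
        have L: "L \<ge> 1" and s: "b \<le> s" using elim by (auto simp: L_def s_def)
        have L\<beta>: "L powr \<beta> * L powr p = L" using L \<beta>(3) by (simp flip: powr_add)
        have dn: "d n = s * L powr \<beta>" using L by (simp add: s_def)
        have "K * min 1 b \<le> K * (s / max 1 s)"
          using K(1) b(1) s by (intro mult_left_mono) (auto simp: max_def min_def field_simps)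
        also have "\<dots> = real n powr p * (d n / L) * (K * ((L / real n) powr p / max 1 s))"
        proof -
          have "real n powr p * (d n / L) * (K * ((L / real n) powr p / max 1 s)) =
              K * (s / max 1 s) * (L powr \<beta> * L powr p / L)"
            using elim(4) L by (simp add: dn powr_divide mult_ac)
          then show ?thesis using L by (simp add: L\<beta>)
        qed
        finally have "ennreal (K * min 1 b) \<le>
            ennreal (real n powr p * (d n / L)) * ennreal (K * ((L / real n) powr p / max 1 s))"
          using K(1) by (subst ennreal_mult''[symmetric]) (auto intro!: ennreal_leI mult_nonneg_nonneg divide_nonneg_nonneg)
        also have "\<dots> \<le> ennreal (real n powr p * (d n / L)) * S1 \<delta> n"
          using elim(1) by (intro mult_left_mono) (auto simp: L_def s_def)
        finally show ?case by (simp add: L_def)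
      qed
    qed
    moreover have "K * min 1 b > 0" using K(1) b(1) by simp
    ultimately show ?thesis by (meson ennreal_less_zero_iff less_le_trans)
  qed
  show ?thesis
    using part1 part2 part3 unfolding S1_def S2_def \<beta>(4) p_def[symmetric]
    by (intro conjI impI allI) (auto intro!: INF_eqI)
qed

end
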